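(* For $k\in\mathbb{N}$ let $I_k:=\int_{(0,\infty)^k}\mathrm{d}u\,\frac{|u|_1e^{-|u|_1}}{\prod_{j=1}^k(u_j+u_{j+1})}$, with $u_{k+1}:=u_1$ and $|u|_1:=u_1+\dots+u_k$ for $u\in(0,\infty)^k$. Then for every $n\in\mathbb{N}$ with $n\ge2$, \[ I_n=(2\pi)^{n-2}\frac{\big(\Gamma(\tfrac n2)\big)^2}{\Gamma(n)}, \] and for every $n\in\mathbb{N}$, \[ I_{2n}=(2\pi)^{2n-2}\frac{[(n-1)!]^2}{(2n-1)!}=nJ_{2n},\qquad J_{2n}:=\pi^{2(n-1)}2^{2n-1}\frac{[(n-1)!]^2}{(2n)!}. \]
   Context: $\Gamma$ denotes Euler's Gamma function. *)

theory Defs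
  imports "HOL-Analysis.Analysis"
begin

text \<open>I_k as a (nonnegative) Lebesgue integral over (0,oo)^k. Points of R^k are
functions u :: nat => real on the index set {0..<k} (product measure of lborel);
coordinates u_1..u_k are u 0 .. u (k-1), and the cyclic convention u_{k+1} = u_1
becomes u ((j+1) mod k).\<close>

definition I_int :: "nat \<Rightarrow> ennreal" where
  "I_int k = (\<integral>\<^sup>+ u. indicator {u. \<forall>j<k. 0 < u j} u *
      ennreal ((\<Sum>j<k. u j) * exp (- (\<Sum>j<k. u j)) / (\<Prod>j<k. u j + u ((j + 1) mod k)))
     \<partial>(PiM {..<k} (\<lambda>_. lborel)))"

end

theory Submission
  imports Defs "HOL-Real_Asymp.Real_Asymp"
begin

text \<open>
  The product in the denominator is homogeneous of degree \<open>k\<close>, so substituting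
  \<open>u\<^sub>j = y exp (2 t\<^sub>j)\<close> with \<open>y\<close> the last coordinate and integrating out \<open>y\<close>
  turns \<open>I\<^sub>k\<close> into half the value at 0 of the \<open>k\<close>-fold convolution power \<open>q\<^sub>k\<close> of
  \<open>sech\<close>. Let \<open>D\<close> denote multiplication by \<open>s\<^sup>2\<close>. The identity
  \<open>(a+b+c)\<^sup>2 + a\<^sup>2 + b\<^sup>2 + c\<^sup>2 = (a+b)\<^sup>2 + (b+c)\<^sup>2 + (a+c)\<^sup>2\<close> gives a relation between
  \<open>D\<close>-weighted triple convolutions in which all terms are nonnegative. Together with closed forms
  for \<open>q\<^sub>2\<close>, \<open>q\<^sub>3\<close>, \<open>q\<^sub>4\<close> it yields, by induction,
  \<open>n\<^sup>2 \<pi>\<^sup>2 q(n) + 4 D q(n) = n (n + 1) q(n + 2)\<close>. At \<open>s = 0\<close> this is the recurrence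
  satisfied by the Gamma quotient.
\<close>

section \<open>Convolution of nonnegative functions\<close>

text \<open>Values lie in \<open>ennreal\<close> so that Tonelli applies without integrability
  conditions. Finiteness enters only where terms have to be cancelled.\<close>

definition nnconv :: "(real \<Rightarrow> ennreal) \<Rightarrow> (real \<Rightarrow> ennreal) \<Rightarrow> real \<Rightarrow> ennreal" where
  "nnconv f h s = (\<integral>\<^sup>+t. f t * h (s - t) \<partial>lborel)"

text \<open>The operator \<open>D\<close> of the overview. On the Fourier side it is minus the
  second derivative.\<close>

definition sqw :: "(real \<Rightarrow> ennreal) \<Rightarrow> real \<Rightarrow> ennreal" where
  "sqw f s = ennreal (s\<^sup>2) * f s"

lemma measurable_nnconv [measurable]:
  assumes [measurable]: "f \<in> borel_measurable borel" "h \<in> borel_measurable borel"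
  shows "nnconv f h \<in> borel_measurable borel"
  unfolding nnconv_def by measurable

lemma measurable_sqw [measurable]:
  assumes [measurable]: "f \<in> borel_measurable borel"
  shows "sqw f \<in> borel_measurable borel"
  unfolding sqw_def by measurable

lemma nn_integral_reflect:
  fixes f :: "real \<Rightarrow> ennreal"
  assumes [measurable]: "f \<in> borel_measurable borel"
  shows "(\<integral>\<^sup>+t. f (s - t) \<partial>lborel) = (\<integral>\<^sup>+t. f t \<partial>lborel)"
  using nn_integral_real_affine[of f "-1" s] by simp

lemma nn_integral_shift:
  fixes f :: "real \<Rightarrow> ennreal"
  assumes [measurable]: "f \<in> borel_measurable borel"
  shows "(\<integral>\<^sup>+t. f (t + s) \<partial>lborel) = (\<integral>\<^sup>+t. f t \<partial>lborel)"
  using nn_integral_real_affine[of f 1 s] by (simp add: add.commute)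

lemma nn_integral_lborel_swap:
  fixes f :: "real \<Rightarrow> real \<Rightarrow> ennreal"
  assumes "case_prod f \<in> borel_measurable (borel \<Otimes>\<^sub>M borel)"
  shows "(\<integral>\<^sup>+y. \<integral>\<^sup>+x. f x y \<partial>lborel \<partial>lborel) = (\<integral>\<^sup>+x. \<integral>\<^sup>+y. f x y \<partial>lborel \<partial>lborel)"
  by (rule lborel_pair.Fubini') (use assms in simp)

lemma nnconv_commute:
  assumes [measurable]: "f \<in> borel_measurable borel" "h \<in> borel_measurable borel"
  shows "nnconv f h = nnconv h f"
proof
  fix s
  show "nnconv f h s = nnconv h f s"
    unfolding nnconv_def
    using nn_integral_reflect[of "\<lambda>t. f t * h (s - t)" s] by (simp add: mult.commute)
qed

lemma nnconv_nnconv_left: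
  assumes [measurable]: "f \<in> borel_measurable borel" "h \<in> borel_measurable borel"
    "k \<in> borel_measurable borel"
  shows "nnconv (nnconv f h) k s = (\<integral>\<^sup>+t. \<integral>\<^sup>+r. f r * h (t - r) * k (s - t) \<partial>lborel \<partial>lborel)"
  unfolding nnconv_def by (simp add: nn_integral_multc)

text \<open>Shifting the inner variable by \<open>r\<close> and swapping the integrals gives the
  same double integral as the left bracketing, whence associativity.\<close>

lemma nnconv_nnconv_right:
  assumes [measurable]: "f \<in> borel_measurable borel" "h \<in> borel_measurable borel"
    "k \<in> borel_measurable borel"
  shows "nnconv f (nnconv h k) s = (\<integral>\<^sup>+t. \<integral>\<^sup>+r. f r * h (t - r) * k (s - t) \<partial>lborel \<partial>lborel)"
proof -
  have "nnconv f (nnconv h k) s = (\<integral>\<^sup>+r. f r * (\<integral>\<^sup>+t. h t * k (s - r - t) \<partial>lborel) \<partial>lborel)"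
    by (simp add: nnconv_def)
  also have "\<dots> = (\<integral>\<^sup>+r. f r * (\<integral>\<^sup>+t. h (t - r) * k (s - t) \<partial>lborel) \<partial>lborel)"
    using nn_integral_shift[of "\<lambda>t. h t * k (s - r - t)" "- r" for r] by simp
  also have "\<dots> = (\<integral>\<^sup>+r. \<integral>\<^sup>+t. f r * h (t - r) * k (s - t) \<partial>lborel \<partial>lborel)"
    by (simp add: nn_integral_cmult mult.assoc)
  also have "\<dots> = (\<integral>\<^sup>+t. \<integral>\<^sup>+r. f r * h (t - r) * k (s - t) \<partial>lborel \<partial>lborel)"
    by (rule nn_integral_lborel_swap) measurable
  finally show ?thesis .
qed

lemma nnconv_assoc:
  assumes "f \<in> borel_measurable borel" "h \<in> borel_measurable borel" "k \<in> borel_measurable borel"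
  shows "nnconv (nnconv f h) k = nnconv f (nnconv h k)"
  using assms by (simp add: fun_eq_iff nnconv_nnconv_left nnconv_nnconv_right)

lemma nnconv_lincomb_left:
  assumes [measurable]: "f \<in> borel_measurable borel" "h \<in> borel_measurable borel"
    "k \<in> borel_measurable borel"
  shows "nnconv (\<lambda>t. a * f t + b * h t) k s = a * nnconv f k s + b * nnconv h k s"
  unfolding nnconv_def
  by (simp add: distrib_right mult.assoc nn_integral_add nn_integral_cmult)

lemma nnconv_cmult_left:
  assumes [measurable]: "f \<in> borel_measurable borel" "k \<in> borel_measurable borel"
  shows "nnconv (\<lambda>t. a * f t) k s = a * nnconv f k s"
  unfolding nnconv_def by (simp add: mult.assoc nn_integral_cmult)

text \<open>Every term is the same double integral \<open>J\<close> with a different weight. With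
  \<open>a = r\<close>, \<open>b = t - r\<close>, \<open>c = s - t\<close> for the arguments of
  \<open>f\<close>, \<open>h\<close>, \<open>k\<close>, the weights on the left are the squares of
  \<open>a + b + c\<close>, \<open>a\<close>, \<open>b\<close>, \<open>c\<close>, and those on the
  right the squares of \<open>a + b\<close>, \<open>b + c\<close>, \<open>a + c\<close>. The two
  sums of weights agree, and no subtraction in \<open>ennreal\<close> occurs.\<close>

lemma sqw_nnconv3:
  assumes [measurable]: "f \<in> borel_measurable borel" "h \<in> borel_measurable borel"
    "k \<in> borel_measurable borel"
  shows "sqw (nnconv (nnconv f h) k) s + nnconv (nnconv (sqw f) h) k s
       + nnconv (nnconv f (sqw h)) k s + nnconv (nnconv f h) (sqw k) s
     = nnconv (sqw (nnconv f h)) k s + nnconv f (sqw (nnconv h k)) s + nnconv (sqw (nnconv f k)) h s"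
proof -
  define J where "J w = (\<integral>\<^sup>+t. \<integral>\<^sup>+r. ennreal (w t r) * (f r * h (t - r) * k (s - t)) \<partial>lborel \<partial>lborel)"
    for w :: "real \<Rightarrow> real \<Rightarrow> real"
  have J_add: "J v + J w = J (\<lambda>t r. v t r + w t r)"
    if [measurable]: "case_prod v \<in> borel_measurable (borel \<Otimes>\<^sub>M borel)" "case_prod w \<in> borel_measurable (borel \<Otimes>\<^sub>M borel)"
      and "\<And>t r. v t r \<ge> 0" "\<And>t r. w t r \<ge> 0" for v w
    unfolding J_def using that(3,4)
    by (simp add: nn_integral_add[symmetric] distrib_right)
  have 1: "sqw (nnconv (nnconv f h) k) s = J (\<lambda>t r. s\<^sup>2)"
    unfolding sqw_def J_def by (subst nnconv_nnconv_left) (simp_all add: nn_integral_cmult)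
  have 2: "nnconv (nnconv (sqw f) h) k s = J (\<lambda>t r. r\<^sup>2)"
    unfolding J_def by (subst nnconv_nnconv_left) (simp_all add: sqw_def mult_ac)
  have 3: "nnconv (nnconv f (sqw h)) k s = J (\<lambda>t r. (t - r)\<^sup>2)"
    unfolding J_def by (subst nnconv_nnconv_left) (simp_all add: sqw_def mult_ac)
  have 4: "nnconv (nnconv f h) (sqw k) s = J (\<lambda>t r. (s - t)\<^sup>2)"
    unfolding J_def by (subst nnconv_nnconv_left) (simp_all add: sqw_def mult_ac)
  have 5: "nnconv (sqw (nnconv f h)) k s = J (\<lambda>t r. t\<^sup>2)"
    unfolding nnconv_def sqw_def J_def
    by (intro nn_integral_cong) (simp add: nn_integral_multc[symmetric] nn_integral_cmult[symmetric] mult_ac)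
  have 6: "nnconv f (sqw (nnconv h k)) s = J (\<lambda>t r. (s - r)\<^sup>2)"
  proof -
    have "nnconv f (sqw (nnconv h k)) s = (\<integral>\<^sup>+r. f r * (ennreal ((s - r)\<^sup>2) * (\<integral>\<^sup>+t. h t * k (s - r - t) \<partial>lborel)) \<partial>lborel)"
      by (simp add: nnconv_def sqw_def)
    also have "\<dots> = (\<integral>\<^sup>+r. f r * (ennreal ((s - r)\<^sup>2) * (\<integral>\<^sup>+t. h (t - r) * k (s - t) \<partial>lborel)) \<partial>lborel)"
      using nn_integral_shift[of "\<lambda>t. h t * k (s - r - t)" "- r" for r] by simp
    also have "\<dots> = (\<integral>\<^sup>+r. \<integral>\<^sup>+t. ennreal ((s - r)\<^sup>2) * (f r * h (t - r) * k (s - t)) \<partial>lborel \<partial>lborel)"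
      by (intro nn_integral_cong) (simp add: nn_integral_cmult[symmetric] mult_ac)
    also have "\<dots> = J (\<lambda>t r. (s - r)\<^sup>2)"
      unfolding J_def by (rule nn_integral_lborel_swap) measurable
    finally show ?thesis .
  qed
  \<comment> \<open>Here the paired factors \<open>f\<close> and \<open>k\<close> are not
    neighbours. Reflecting \<open>t\<close> to \<open>s + r - t\<close> exchanges the arguments of
    \<open>h\<close> and \<open>k\<close> and turns the weight into \<open>t^2\<close>.\<close>
  have 7: "nnconv (sqw (nnconv f k)) h s = J (\<lambda>t r. (s - t + r)\<^sup>2)"
  proof -
    have "J (\<lambda>t r. (s - t + r)\<^sup>2) = (\<integral>\<^sup>+r. \<integral>\<^sup>+t. ennreal ((s - t + r)\<^sup>2) * (f r * h (t - r) * k (s - t)) \<partial>lborel \<partial>lborel)"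
      unfolding J_def by (rule nn_integral_lborel_swap[symmetric]) measurable
    also have "\<dots> = (\<integral>\<^sup>+r. \<integral>\<^sup>+t. ennreal (t\<^sup>2) * (f r * h (s - t) * k (t - r)) \<partial>lborel \<partial>lborel)"
      (is "(\<integral>\<^sup>+r. ?L r \<partial>_) = (\<integral>\<^sup>+r. ?R r \<partial>_)")
    proof (rule nn_integral_cong)
      fix r
      show "?L r = ?R r"
        using nn_integral_reflect[of "\<lambda>t. ennreal ((s - t + r)\<^sup>2) * (f r * h (t - r) * k (s - t))" "s + r"]
        by (simp add: algebra_simps)
    qed
    also have "\<dots> = (\<integral>\<^sup>+t. \<integral>\<^sup>+r. ennreal (t\<^sup>2) * (f r * h (s - t) * k (t - r)) \<partial>lborel \<partial>lborel)"
      by (rule nn_integral_lborel_swap) measurable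
    also have "\<dots> = nnconv (sqw (nnconv f k)) h s"
      unfolding nnconv_def sqw_def
      by (intro nn_integral_cong) (simp add: nn_integral_multc[symmetric] nn_integral_cmult[symmetric] mult_ac)
    finally show ?thesis by simp
  qed
  have "J (\<lambda>t r. s\<^sup>2) + J (\<lambda>t r. r\<^sup>2) + J (\<lambda>t r. (t - r)\<^sup>2) + J (\<lambda>t r. (s - t)\<^sup>2)
      = J (\<lambda>t r. s\<^sup>2 + r\<^sup>2 + (t - r)\<^sup>2 + (s - t)\<^sup>2)"
    by (simp add: J_add)
  also have "\<dots> = J (\<lambda>t r. t\<^sup>2 + (s - r)\<^sup>2 + (s - t + r)\<^sup>2)"
    by (rule arg_cong[where f = J]) (simp add: fun_eq_iff power2_eq_square algebra_simps)
  also have "\<dots> = J (\<lambda>t r. t\<^sup>2) + J (\<lambda>t r. (s - r)\<^sup>2) + J (\<lambda>t r. (s - t + r)\<^sup>2)"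
    by (simp add: J_add)
  finally show ?thesis
    by (simp add: 1 2 3 4 5 6 7)
qed

section \<open>Integrals of hyperbolic functions\<close>

lemma nn_integral_FTC_UNIV:
  fixes f F :: "real \<Rightarrow> real"
  assumes F: "\<And>x. (F has_real_derivative f x) (at x)" and f: "\<And>x. isCont f x" "\<And>x. 0 \<le> f x"
    and A: "(F \<longlongrightarrow> A) at_bot" and B: "(F \<longlongrightarrow> B) at_top"
  shows "(\<integral>\<^sup>+x. ennreal (f x) \<partial>lborel) = ennreal (B - A)"
proof -
  have "set_integrable lborel (einterval (-\<infinity>) \<infinity>) f" "(LBINT x=-\<infinity>..\<infinity>. f x) = B - A"
    by (rule interval_integral_FTC_nonneg[where F = F]; use assms in \<open>simp add: ereal_tendsto_simps\<close>)+
  then have "integrable lborel f" "integral\<^sup>L lborel f = B - A"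
    by (simp_all add: set_integrable_def interval_lebesgue_integral_def set_lebesgue_integral_def)
  then show ?thesis
    using f by (simp add: nn_integral_eq_integral)
qed

lemma nn_integral_even:
  fixes f :: "real \<Rightarrow> ennreal"
  assumes [measurable]: "f \<in> borel_measurable borel" and even: "\<And>t. f (- t) = f t"
  shows "(\<integral>\<^sup>+t. f t \<partial>lborel) = 2 * (\<integral>\<^sup>+t. f t * indicator {0..} t \<partial>lborel)"
proof -
  \<comment> \<open>Both closed half-lines contain 0, so the splitting holds only almost
    everywhere.\<close>
  have "(\<integral>\<^sup>+t. f t \<partial>lborel) = (\<integral>\<^sup>+t. f t * indicator {0..} t + f t * indicator {..0} t \<partial>lborel)"
    by (intro nn_integral_cong_AE AE_I[where N = "{0}"]) (auto split: split_indicator)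
  also have "\<dots> = (\<integral>\<^sup>+t. f t * indicator {0..} t \<partial>lborel) + (\<integral>\<^sup>+t. f t * indicator {..0} t \<partial>lborel)"
    by (simp add: nn_integral_add)
  also have "(\<integral>\<^sup>+t. f t * indicator {..0} t \<partial>lborel) = (\<integral>\<^sup>+t. f t * indicator {0..} t \<partial>lborel)"
    using nn_integral_reflect[of "\<lambda>t. f t * indicator {..0} t" 0]
    by (simp add: even indicator_def)
  finally show ?thesis
    by (simp add: mult_2)
qed

lemma borel_measurable_cosh_real [measurable (raw)]:
  fixes f :: "'a \<Rightarrow> real"
  assumes "f \<in> borel_measurable M"
  shows "(\<lambda>x. cosh (f x)) \<in> borel_measurable M"
  by (rule borel_measurable_continuous_on[OF _ assms]) (intro continuous_intros)

lemma borel_measurable_sinh_real [measurable (raw)]: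
  fixes f :: "'a \<Rightarrow> real"
  assumes "f \<in> borel_measurable M"
  shows "(\<lambda>x. sinh (f x)) \<in> borel_measurable M"
  by (rule borel_measurable_continuous_on[OF _ assms]) (intro continuous_intros)

lemma borel_measurable_tanh_real [measurable (raw)]:
  fixes f :: "'a \<Rightarrow> real"
  assumes "f \<in> borel_measurable M"
  shows "(\<lambda>x. tanh (f x)) \<in> borel_measurable M"
  by (rule borel_measurable_continuous_on[OF _ assms]) (auto intro!: continuous_intros)

lemma nn_integral_sech: "(\<integral>\<^sup>+t. ennreal (1 / cosh t) \<partial>lborel) = ennreal pi"
proof -
  have "(\<integral>\<^sup>+t. ennreal (1 / cosh t) \<partial>lborel) = ennreal (pi / 2 - - (pi / 2))"
  proof (rule nn_integral_FTC_UNIV)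
    show "((\<lambda>t. arctan (sinh t)) has_real_derivative 1 / cosh x) (at x)" for x
    proof -
      have "cosh x / (1 + (sinh x)\<^sup>2) = 1 / cosh x"
        by (simp add: cosh_square_eq[symmetric] add.commute[of 1]) (simp add: power2_eq_square)
      then show ?thesis
        by (auto intro!: derivative_eq_intros simp: field_simps)
    qed
    show "((\<lambda>t. arctan (sinh t)) \<longlongrightarrow> - (pi / 2)) at_bot"
      using filterlim_compose[OF tendsto_arctan_at_bot sinh_real_at_bot] by simp
    show "((\<lambda>t. arctan (sinh t)) \<longlongrightarrow> pi / 2) at_top"
      using filterlim_compose[OF tendsto_arctan_at_top sinh_real_at_top] by simp
  qed (auto intro!: continuous_intros)
  then show ?thesis by simp
qed

lemma nn_integral_sech_square: "(\<integral>\<^sup>+t. ennreal (1 / (cosh t)\<^sup>2) \<partial>lborel) = 2"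
proof -
  have "(\<integral>\<^sup>+t. ennreal (1 / (cosh t)\<^sup>2) \<partial>lborel) = ennreal (1 - - 1)"
  proof (rule nn_integral_FTC_UNIV)
    show "(tanh has_real_derivative 1 / (cosh x)\<^sup>2) (at x)" for x :: real
    proof -
      have "1 - (tanh x)\<^sup>2 = 1 / (cosh x)\<^sup>2"
        by (simp add: tanh_def power_divide diff_divide_eq_iff) (simp add: cosh_square_eq)
      then show ?thesis
        by (auto intro!: derivative_eq_intros)
    qed
  qed (auto intro!: continuous_intros tanh_real_at_bot tanh_real_at_top)
  then show ?thesis by simp
qed

section \<open>Second moments of \<open>1 / sinh^2\<close> and \<open>1 / cosh^2\<close>\<close>

lemma nn_integral_square_exp:
  assumes "a > 0"
  shows "(\<integral>\<^sup>+t. ennreal (t\<^sup>2 * exp (- a * t)) * indicator {0..} t \<partial>lborel) = ennreal (2 / a ^ 3)"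
proof -
  \<comment> \<open>The antiderivative produced by integrating by parts twice.\<close>
  define F where "F t = - exp (- a * t) * (t\<^sup>2 / a + 2 * t / a\<^sup>2 + 2 / a ^ 3)" for t
  have "(\<integral>\<^sup>+t. ennreal (t\<^sup>2 * exp (- a * t)) * indicator {0..} t \<partial>lborel) = ennreal (0 - F 0)"
  proof (rule nn_integral_FTC_atLeast)
    show "(F has_real_derivative x\<^sup>2 * exp (- a * x)) (at x)" for x
      unfolding F_def using assms
      by (auto intro!: derivative_eq_intros simp: field_simps power2_eq_square power3_eq_cube)
    show "(F \<longlongrightarrow> 0) at_top"
      unfolding F_def using assms by real_asymp
  qed auto
  then show ?thesis by (simp add: F_def)
qed

text \<open>With \<open>z = exp (- 2 * t)\<close> one has
  \<open>1 / sinh^2 t = 4 z / (1 - z)^2\<close>, a multiple of the differentiated geometric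
  series.\<close>

lemma sinh_square_series:
  fixes t :: real
  assumes "t > 0"
  shows "(\<lambda>k. 4 * real (Suc k) * (t\<^sup>2 * exp (- (2 * real (Suc k)) * t))) sums (t\<^sup>2 / (sinh t)\<^sup>2)"
proof -
  define z where "z = exp (- 2 * t)"
  have z: "0 < z" "z < 1" using assms by (auto simp: z_def)
  have "(\<lambda>k. 4 * t\<^sup>2 * z * (of_nat (Suc k) * z ^ k)) sums (4 * t\<^sup>2 * z * (1 / (1 - z)\<^sup>2))"
    by (intro sums_mult geometric_deriv_sums) (use z in auto)
  moreover have "4 * t\<^sup>2 * z * (of_nat (Suc k) * z ^ k) = 4 * real (Suc k) * (t\<^sup>2 * exp (- (2 * real (Suc k)) * t))" for k
  proof -
    have "exp (- (2 * real (Suc k)) * t) = z ^ Suc k"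
      unfolding z_def exp_of_nat_mult[symmetric] by (simp add: algebra_simps)
    then show ?thesis by simp
  qed
  moreover have "4 * t\<^sup>2 * z * (1 / (1 - z)\<^sup>2) = t\<^sup>2 / (sinh t)\<^sup>2"
  proof -
    define y where "y = exp t"
    have y: "y > 1" "z = 1 / y\<^sup>2" "sinh t = (y - 1 / y) / 2"
      using assms by (auto simp: y_def z_def sinh_field_def exp_minus field_simps power2_eq_square exp_add[symmetric])
    have "y\<^sup>2 > 1" using y(1) by (simp add: one_less_power)
    moreover define A where "A = y\<^sup>2 - 1"
    ultimately have "A > 0" "sinh t = A / (2 * y)" "1 - z = A / y\<^sup>2"
      using y by (auto simp: field_simps power2_eq_square)
    then have "4 * t\<^sup>2 * z * (1 / (1 - z)\<^sup>2) = 4 * t\<^sup>2 * (1 / y\<^sup>2) * (1 / (A / y\<^sup>2)\<^sup>2)"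
      using y by simp
    also have "\<dots> = t\<^sup>2 / (A / (2 * y))\<^sup>2"
      using y(1) \<open>A > 0\<close> by (simp add: field_simps power2_eq_square)
    finally show ?thesis
      using \<open>sinh t = A / (2 * y)\<close> by simp
  qed
  ultimately show ?thesis by (simp only:)
qed

text \<open>Integrating the series termwise over the half-line, the term with
  \<open>k + 1 = j\<close> gives \<open>4 j * 2 / (2 j)^3 = 1 / j^2\<close>. The half-line integral
  is therefore the Basel sum, and evenness doubles it.\<close>

lemma nn_integral_square_div_sinh_square:
  "(\<integral>\<^sup>+t. ennreal (t\<^sup>2 / (sinh t)\<^sup>2) \<partial>lborel) = ennreal (pi\<^sup>2 / 3)"
proof -
  have "(\<integral>\<^sup>+t. ennreal (t\<^sup>2 / (sinh t)\<^sup>2) * indicator {0..} t \<partial>lborel)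
      = (\<integral>\<^sup>+t. (\<Sum>k. ennreal (4 * real (Suc k)) * (ennreal (t\<^sup>2 * exp (- (2 * real (Suc k)) * t)) * indicator {0..} t)) \<partial>lborel)"
  proof (intro nn_integral_cong_AE AE_I[where N = "{0}"] subsetI, rule ccontr)
    fix t assume t: "t \<in> {t \<in> space lborel. \<not> ennreal (t\<^sup>2 / (sinh t)\<^sup>2) * indicator {0..} t
       = (\<Sum>k. ennreal (4 * real (Suc k)) * (ennreal (t\<^sup>2 * exp (- (2 * real (Suc k)) * t)) * indicator {0..} t))}" "t \<notin> {0}"
    then have "t > 0" by (cases "t \<ge> 0") auto
    have "(\<Sum>k. ennreal (4 * real (Suc k) * (t\<^sup>2 * exp (- (2 * real (Suc k)) * t)))) = ennreal (t\<^sup>2 / (sinh t)\<^sup>2)"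
      by (rule suminf_ennreal_eq) (use sinh_square_series[OF \<open>t > 0\<close>] in auto)
    then show False
      using t \<open>t > 0\<close> by (simp add: ennreal_mult)
  qed auto
  also have "\<dots> = (\<Sum>k. ennreal (4 * real (Suc k)) * ennreal (2 / (2 * real (Suc k)) ^ 3))"
    by (subst nn_integral_suminf, measurable, intro suminf_cong, subst nn_integral_cmult, measurable,
        subst nn_integral_square_exp) auto
  also have "\<dots> = (\<Sum>k. ennreal (1 / (real k + 1)\<^sup>2))"
  proof (intro suminf_cong)
    fix k
    have "4 * real (Suc k) * (2 / (2 * real (Suc k)) ^ 3) = 1 / (real k + 1)\<^sup>2"
      by (simp add: divide_simps power2_eq_square power3_eq_cube) (simp add: algebra_simps)
    then show "ennreal (4 * real (Suc k)) * ennreal (2 / (2 * real (Suc k)) ^ 3) = ennreal (1 / (real k + 1)\<^sup>2)"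
      by (subst ennreal_mult[symmetric]) auto
  qed
  also have "\<dots> = ennreal (pi\<^sup>2 / 6)"
    by (rule suminf_ennreal_eq) (use inverse_squares_sums in \<open>simp_all add: add.commute\<close>)
  finally show ?thesis
    by (subst nn_integral_even) (simp_all flip: ennreal_numeral ennreal_mult)
qed

lemma nn_integral_square_div_cosh_square:
  "(\<integral>\<^sup>+t. ennreal (t\<^sup>2 / (cosh t)\<^sup>2) \<partial>lborel) = ennreal (pi\<^sup>2 / 6)"
proof -
  \<comment> \<open>uses \<open>1 / sinh\<^sup>2 t - 1 / cosh\<^sup>2 t = 4 / sinh\<^sup>2 (2 t)\<close>\<close>
  define X where "X = (\<integral>\<^sup>+t. ennreal (t\<^sup>2 / (cosh t)\<^sup>2) \<partial>lborel)"
  have "X + (\<integral>\<^sup>+t. ennreal ((2 * t)\<^sup>2 / (sinh (2 * t))\<^sup>2) \<partial>lborel)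
      = (\<integral>\<^sup>+t. ennreal (t\<^sup>2 / (cosh t)\<^sup>2) + ennreal ((2 * t)\<^sup>2 / (sinh (2 * t))\<^sup>2) \<partial>lborel)"
    unfolding X_def by (simp add: nn_integral_add)
  also have "\<dots> = (\<integral>\<^sup>+t. ennreal (t\<^sup>2 / (sinh t)\<^sup>2) \<partial>lborel)"
  proof (rule nn_integral_cong)
    fix t :: real
    show "ennreal (t\<^sup>2 / (cosh t)\<^sup>2) + ennreal ((2 * t)\<^sup>2 / (sinh (2 * t))\<^sup>2) = ennreal (t\<^sup>2 / (sinh t)\<^sup>2)"
    proof (cases "t = 0")
      case False
      then have "t\<^sup>2 / (cosh t)\<^sup>2 + (2 * t)\<^sup>2 / (sinh (2 * t))\<^sup>2 = t\<^sup>2 * ((sinh t)\<^sup>2 + 1) / ((sinh t)\<^sup>2 * (cosh t)\<^sup>2)"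
        unfolding sinh_double by (simp add: power_mult_distrib divide_simps distrib_left)
      also have "\<dots> = t\<^sup>2 / (sinh t)\<^sup>2"
        by (simp add: cosh_square_eq[symmetric])
      finally show ?thesis by (simp flip: ennreal_plus)
    qed auto
  qed
  finally have "X + (\<integral>\<^sup>+t. ennreal ((2 * t)\<^sup>2 / (sinh (2 * t))\<^sup>2) \<partial>lborel) = ennreal (pi\<^sup>2 / 3)"
    by (simp add: nn_integral_square_div_sinh_square)
  moreover have "ennreal (pi\<^sup>2 / 3) = 2 * (\<integral>\<^sup>+t. ennreal ((2 * t)\<^sup>2 / (sinh (2 * t))\<^sup>2) \<partial>lborel)"
    using nn_integral_real_affine[of "\<lambda>t. ennreal (t\<^sup>2 / (sinh t)\<^sup>2)" 2 0]
    by (simp add: nn_integral_square_div_sinh_square)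
  \<comment> \<open>The integral at the doubled argument is finite, so it may be cancelled; by
    scaling it is half of \<open>pi^2 / 3\<close>.\<close>
  moreover obtain y where "y \<ge> 0" "(\<integral>\<^sup>+t. ennreal ((2 * t)\<^sup>2 / (sinh (2 * t))\<^sup>2) \<partial>lborel) = ennreal y"
    using calculation(2) by (cases "\<integral>\<^sup>+t. ennreal ((2 * t)\<^sup>2 / (sinh (2 * t))\<^sup>2) \<partial>lborel") auto
  ultimately have "X + ennreal y = ennreal (pi\<^sup>2 / 3)" "ennreal (pi\<^sup>2 / 3) = ennreal (2 * y)" "y \<ge> 0"
    by (auto simp: ennreal_mult)
  then have "X + ennreal y = ennreal y + ennreal y" "y = pi\<^sup>2 / 6"
    by (auto simp: ennreal_plus[symmetric] simp del: ennreal_plus)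
  then show ?thesis
    unfolding X_def by (simp add: ennreal_add_left_cancel add.commute)
qed

section \<open>Quadratic weights integrated against \<open>sech^2\<close> and against sums of
  \<open>tanh\<close>\<close>

lemma nn_integral_quadratic_sech_square:
  fixes a b d r :: real
  assumes w: "\<And>t. a * t\<^sup>2 + 2 * b * t + d \<ge> 0" and a: "a \<ge> 0"
  shows "(\<integral>\<^sup>+t. ennreal ((a * t\<^sup>2 + 2 * b * t + d) / (cosh (r - t))\<^sup>2) \<partial>lborel)
    = ennreal (2 * (a * r\<^sup>2 + 2 * b * r + d) + a * pi\<^sup>2 / 6)"
proof -
  define W where "W t = a * t\<^sup>2 + 2 * b * t + d" for t
  have W: "W t \<ge> 0" for t using w by (simp add: W_def)
  have [measurable]: "W \<in> borel_measurable borel" unfolding W_def by measurable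
  define L where "L = (\<integral>\<^sup>+t. ennreal (W t / (cosh (r - t))\<^sup>2) \<partial>lborel)"
  have 1: "L = (\<integral>\<^sup>+t. ennreal (W (r - t) / (cosh t)\<^sup>2) \<partial>lborel)"
    unfolding L_def using nn_integral_reflect[of "\<lambda>t. ennreal (W (r - t) / (cosh t)\<^sup>2)" r] by simp
  also have "\<dots> = (\<integral>\<^sup>+t. ennreal (W (r + t) / (cosh t)\<^sup>2) \<partial>lborel)"
    using nn_integral_reflect[of "\<lambda>t. ennreal (W (r + t) / (cosh t)\<^sup>2)" 0] by simp
  finally have 2: "L = (\<integral>\<^sup>+t. ennreal (W (r + t) / (cosh t)\<^sup>2) \<partial>lborel)" .
  \<comment> \<open>Averaging over \<open>t\<close> and \<open>- t\<close> removes the odd part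
    while all weights stay nonnegative: \<open>W (r - t) + W (r + t) = 2 W r + 2 a t^2\<close>. Only
    the mass 2 and the second moment \<open>pi^2 / 6\<close> of \<open>sech^2\<close>
    remain.\<close>
  have "2 * L = (\<integral>\<^sup>+t. ennreal (W (r - t) / (cosh t)\<^sup>2) + ennreal (W (r + t) / (cosh t)\<^sup>2) \<partial>lborel)"
    by (subst nn_integral_add) (simp_all add: mult_2 flip: 1 2)
  also have "\<dots> = (\<integral>\<^sup>+t. ennreal (2 * W r) * ennreal (1 / (cosh t)\<^sup>2) + ennreal (2 * a) * ennreal (t\<^sup>2 / (cosh t)\<^sup>2) \<partial>lborel)"
  proof (rule nn_integral_cong)
    fix t :: real
    have "W (r - t) / (cosh t)\<^sup>2 + W (r + t) / (cosh t)\<^sup>2 = 2 * W r * (1 / (cosh t)\<^sup>2) + 2 * a * (t\<^sup>2 / (cosh t)\<^sup>2)"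
      unfolding W_def by (simp add: add_divide_distrib[symmetric] power2_eq_square algebra_simps)
    then show "ennreal (W (r - t) / (cosh t)\<^sup>2) + ennreal (W (r + t) / (cosh t)\<^sup>2)
       = ennreal (2 * W r) * ennreal (1 / (cosh t)\<^sup>2) + ennreal (2 * a) * ennreal (t\<^sup>2 / (cosh t)\<^sup>2)"
      using W a by (simp add: ennreal_plus[symmetric] ennreal_mult[symmetric] del: ennreal_plus)
  qed
  also have "\<dots> = ennreal (2 * W r) * 2 + ennreal (2 * a) * ennreal (pi\<^sup>2 / 6)"
    by (simp add: nn_integral_add nn_integral_cmult nn_integral_sech_square nn_integral_square_div_cosh_square)
  also have "\<dots> = ennreal (2 * W r * 2 + 2 * a * (pi\<^sup>2 / 6))"
    using W[of r] a by (simp flip: ennreal_numeral ennreal_mult ennreal_plus add: ennreal_mult[symmetric])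
  finally have eq: "2 * L = ennreal (2 * (2 * W r + a * pi\<^sup>2 / 6))"
    by (simp add: algebra_simps)
  then obtain y where y: "y \<ge> 0" "L = ennreal y"
    by (cases L) auto
  then have "ennreal (2 * y) = ennreal (2 * (2 * W r + a * pi\<^sup>2 / 6))"
    using eq by (simp only: ennreal_mult ennreal_numeral zero_le_numeral)
  then have "y = 2 * W r + a * pi\<^sup>2 / 6"
    using y(1) W[of r] a by (subst (asm) ennreal_inj) auto
  then show ?thesis
    using y(2) unfolding L_def W_def by simp
qed

text \<open>Since \<open>tanh\<close> has derivative \<open>sech^2\<close>, the sum
  \<open>tanh t + tanh (s - t)\<close> is the integral of \<open>sech^2 (r - t)\<close> over
  \<open>r\<close> from 0 to \<open>s\<close>; then Tonelli.\<close>

lemma nn_integral_tanh_sum: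
  fixes w :: "real \<Rightarrow> real"
  assumes [measurable]: "w \<in> borel_measurable borel" and w: "\<And>t. w t \<ge> 0" and s: "s \<ge> 0"
  shows "(\<integral>\<^sup>+t. ennreal (w t * (tanh t + tanh (s - t))) \<partial>lborel)
    = (\<integral>\<^sup>+r. (\<integral>\<^sup>+t. ennreal (w t / (cosh (r - t))\<^sup>2) \<partial>lborel) * indicator {0..s} r \<partial>lborel)"
proof -
  have inner: "(\<integral>\<^sup>+r. ennreal (1 / (cosh (r - t))\<^sup>2) * indicator {0..s} r \<partial>lborel) = ennreal (tanh t + tanh (s - t))" for t
  proof -
    have "(\<integral>\<^sup>+r. ennreal (1 / (cosh (r - t))\<^sup>2) * indicator {0..s} r \<partial>lborel) = tanh (s - t) - tanh (0 - t)"
    proof (rule nn_integral_FTC_Icc)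
      show "((\<lambda>r. tanh (r - t)) has_real_derivative 1 / (cosh (x - t))\<^sup>2) (at x)" for x
      proof -
        have "1 - (tanh (x - t))\<^sup>2 = 1 / (cosh (x - t))\<^sup>2"
          by (simp add: tanh_def power_divide diff_divide_eq_iff) (simp add: cosh_square_eq)
        then show "((\<lambda>r. tanh (r - t)) has_real_derivative 1 / (cosh (x - t))\<^sup>2) (at x)"
          by (auto intro!: derivative_eq_intros)
      qed
    qed (use s in auto)
    then show ?thesis by (simp add: add.commute)
  qed
  have "(\<integral>\<^sup>+t. ennreal (w t * (tanh t + tanh (s - t))) \<partial>lborel)
      = (\<integral>\<^sup>+t. ennreal (w t) * (\<integral>\<^sup>+r. ennreal (1 / (cosh (r - t))\<^sup>2) * indicator {0..s} r \<partial>lborel) \<partial>lborel)"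
    unfolding inner using w by (simp add: ennreal_mult')
  also have "\<dots> = (\<integral>\<^sup>+t. \<integral>\<^sup>+r. ennreal (w t / (cosh (r - t))\<^sup>2) * indicator {0..s} r \<partial>lborel \<partial>lborel)"
    using w by (simp add: nn_integral_cmult[symmetric] mult.assoc[symmetric] ennreal_mult[symmetric])
  also have "\<dots> = (\<integral>\<^sup>+r. \<integral>\<^sup>+t. ennreal (w t / (cosh (r - t))\<^sup>2) * indicator {0..s} r \<partial>lborel \<partial>lborel)"
    by (rule nn_integral_lborel_swap) measurable
  also have "\<dots> = (\<integral>\<^sup>+r. (\<integral>\<^sup>+t. ennreal (w t / (cosh (r - t))\<^sup>2) \<partial>lborel) * indicator {0..s} r \<partial>lborel)"
    by (intro nn_integral_cong nn_integral_multc) measurable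
  finally show ?thesis .
qed

lemma nn_integral_quadratic_tanh_sum:
  fixes a b d s :: real
  assumes w: "\<And>t. a * t\<^sup>2 + 2 * b * t + d \<ge> 0" and a: "a \<ge> 0" and s: "s \<ge> 0"
  shows "(\<integral>\<^sup>+t. ennreal ((a * t\<^sup>2 + 2 * b * t + d) * (tanh t + tanh (s - t))) \<partial>lborel)
    = ennreal (2 * (a * s ^ 3 / 3 + b * s\<^sup>2 + d * s) + a * pi\<^sup>2 / 6 * s)"
proof -
  define F where "F r = 2 * (a * r ^ 3 / 3 + b * r\<^sup>2 + d * r) + a * pi\<^sup>2 / 6 * r" for r
  have "(\<integral>\<^sup>+t. ennreal ((a * t\<^sup>2 + 2 * b * t + d) * (tanh t + tanh (s - t))) \<partial>lborel)
      = (\<integral>\<^sup>+r. ennreal (2 * (a * r\<^sup>2 + 2 * b * r + d) + a * pi\<^sup>2 / 6) * indicator {0..s} r \<partial>lborel)"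
    by (subst nn_integral_tanh_sum) (simp_all only: nn_integral_quadratic_sech_square[OF w a], use assms in auto)
  also have "\<dots> = ennreal (F s - F 0)"
  proof (rule nn_integral_FTC_Icc)
    show "(F has_real_derivative 2 * (a * x\<^sup>2 + 2 * b * x + d) + a * pi\<^sup>2 / 6) (at x)" for x
      unfolding F_def
      by (auto intro!: derivative_eq_intros simp: power2_eq_square algebra_simps)
    show "0 \<le> 2 * (a * x\<^sup>2 + 2 * b * x + d) + a * pi\<^sup>2 / 6" for x
      using w[of x] a by simp
  qed (use s in auto)
  finally show ?thesis by (simp add: F_def)
qed

section \<open>Convolution powers of the hyperbolic secant\<close>

lemma ennreal_mult_eq_imp_divide:
  assumes "ennreal x * X = ennreal y" "x > 0" "y \<ge> 0"
  shows "X = ennreal (y / x)"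
proof (cases X)
  case (real z)
  then have "x * z = y"
    using assms by (simp add: ennreal_mult[symmetric])
  then show ?thesis
    using real assms by (simp add: field_simps)
qed (use assms in \<open>auto simp: ennreal_mult_top\<close>)

text \<open>Links the two kinds of integral: multiplied by \<open>sinh s\<close>, the convolution
  kernel of two \<open>sech\<close> factors becomes a sum of \<open>tanh\<close>.\<close>

lemma tanh_sum_eq: "tanh t + tanh (s - t) = sinh s / (cosh t * cosh (s - t))" for s t :: real
  using sinh_add[of t "s - t"] by (simp add: tanh_def field_simps)

text \<open>The function \<open>2 s / sinh s\<close> with its removable singularity filled in; it
  turns out to be the twofold convolution power of \<open>sech\<close>.\<close>

definition csinh :: "real \<Rightarrow> real" where
  "csinh s = (if s = 0 then 2 else 2 * s / sinh s)"

lemma csinh_nonneg: "csinh s \<ge> 0"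
  by (cases "s \<ge> 0") (auto simp: csinh_def divide_nonpos_nonpos)

lemma csinh_minus [simp]: "csinh (- s) = csinh s"
  by (simp add: csinh_def)

lemma borel_measurable_csinh [measurable]: "csinh \<in> borel_measurable borel"
  unfolding csinh_def by measurable

text \<open>For \<open>s > 0\<close> multiply by \<open>sinh s\<close>, apply the formula for
  \<open>tanh\<close> sums and divide again. Negative \<open>s\<close> follows from evenness, as the
  weight has no linear term.\<close>

lemma nn_integral_quadratic_sech_sech:
  fixes a d s :: real
  assumes a: "a \<ge> 0" and d: "d \<ge> 0"
  shows "(\<integral>\<^sup>+t. ennreal ((a * t\<^sup>2 + d) / (cosh t * cosh (s - t))) \<partial>lborel)
    = ennreal ((a * s\<^sup>2 / 3 + a * pi\<^sup>2 / 12 + d) * csinh s)" (is "?L s = ?R s")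
proof -
  have pos: "?L s = ?R s" if "s > 0" for s
  proof -
    have "ennreal (sinh s) * ?L s = (\<integral>\<^sup>+t. ennreal ((a * t\<^sup>2 + 2 * 0 * t + d) * (tanh t + tanh (s - t))) \<partial>lborel)"
      using a d that unfolding tanh_sum_eq
      by (subst nn_integral_cmult[symmetric]) (auto simp: ennreal_mult[symmetric] mult_ac)
    also have "\<dots> = ennreal (2 * (a * s ^ 3 / 3 + 0 * s\<^sup>2 + d * s) + a * pi\<^sup>2 / 6 * s)"
      by (rule nn_integral_quadratic_tanh_sum) (use a d that in auto)
    finally have "?L s = ennreal ((2 * (a * s ^ 3 / 3 + 0 * s\<^sup>2 + d * s) + a * pi\<^sup>2 / 6 * s) / sinh s)"
      by (rule ennreal_mult_eq_imp_divide) (use a d that in auto)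
    moreover have "(2 * (a * s ^ 3 / 3 + 0 * s\<^sup>2 + d * s) + a * pi\<^sup>2 / 6 * s) / sinh s
        = (a * s\<^sup>2 / 3 + a * pi\<^sup>2 / 12 + d) * csinh s"
      using that by (simp add: csinh_def field_simps power2_eq_square power3_eq_cube)
    ultimately show ?thesis by (simp only:)
  qed
  have nonneg: "d + t * (t * a) \<ge> 0" for t
    using mult_nonneg_nonneg[OF zero_le_square[of t] a] d by (simp add: mult.assoc)
  \<comment> \<open>At \<open>s = 0\<close> the factor \<open>sinh s\<close> vanishes and cannot be
    divided out, but there the kernel is \<open>sech^2\<close> itself.\<close>
  have zero: "?L 0 = ?R 0"
    using nn_integral_quadratic_sech_square[of a 0 d 0, OF _ a] nonneg a d
    by (simp add: csinh_def power2_eq_square algebra_simps)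
  have "?L (- s) = ?L s" for s
  proof -
    have *: "cosh (- s - t) = cosh (s + t)" for t
      using cosh_minus[of "s + t"] by simp
    show ?thesis
      unfolding * using nn_integral_reflect[of "\<lambda>t. ennreal ((a * t\<^sup>2 + d) / (cosh t * cosh (s - t)))" 0]
      by simp
  qed
  then show ?thesis
    using pos[of s] pos[of "- s"] zero by (cases s "0 :: real" rule: linorder_cases) auto
qed

section \<open>Convolution powers of \<open>sech\<close> and their closed forms up to order
  four\<close>

definition esech :: "real \<Rightarrow> ennreal" where
  "esech t = ennreal (1 / cosh t)"

lemma measurable_esech [measurable]: "esech \<in> borel_measurable borel"
  unfolding esech_def by measurable

text \<open>Index shift: \<open>sechc n\<close> is the \<open>(n + 1)\<close>-fold convolution power.\<close>

fun sechc :: "nat \<Rightarrow> real \<Rightarrow> ennreal" where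
  "sechc 0 = esech"
| "sechc (Suc n) = nnconv (sechc n) esech"

lemma measurable_sechc [measurable]: "sechc n \<in> borel_measurable borel"
  by (induction n) auto

lemma nnconv_sechc: "nnconv (sechc m) (sechc n) = sechc (Suc (m + n))"
proof (induction n)
  case (Suc n)
  have "nnconv (sechc m) (sechc (Suc n)) = nnconv (nnconv (sechc m) (sechc n)) esech"
    by (simp add: nnconv_assoc)
  then show ?case using Suc by simp
qed simp

lemma sechc_minus: "sechc n (- s) = sechc n s"
proof (induction n arbitrary: s)
  case (Suc n)
  have "esech (- s - t) = esech (s + t)" for t
    unfolding esech_def using cosh_minus[of "s + t"] by simp
  then show ?case
    using nn_integral_reflect[of "\<lambda>t. sechc n t * esech (s - t)" 0] Suc
    by (simp add: nnconv_def)
qed (simp add: esech_def)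

text \<open>Because \<open>sech\<close> is at most 1 and has mass \<open>pi\<close>, each further
  convolution costs at most a factor \<open>pi\<close>. The bound serves to make all powers
  finite.\<close>

lemma sechc_le: "sechc n s \<le> ennreal (pi ^ n)"
proof (induction n arbitrary: s)
  case 0
  show ?case by (simp add: esech_def cosh_real_ge_1)
next
  case (Suc n)
  have "sechc (Suc n) s \<le> (\<integral>\<^sup>+t. ennreal (pi ^ n) * esech (s - t) \<partial>lborel)"
    unfolding sechc.simps nnconv_def by (intro nn_integral_mono mult_right_mono Suc) auto
  also have "\<dots> = ennreal (pi ^ n) * (\<integral>\<^sup>+t. esech t \<partial>lborel)"
    by (simp add: nn_integral_cmult nn_integral_reflect)
  also have "\<dots> = ennreal (pi ^ Suc n)"
    by (simp add: esech_def nn_integral_sech mult.commute flip: ennreal_mult)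
  finally show ?case .
qed

lemma sechc_finite: "sechc n s < \<infinity>"
  using sechc_le[of n s] by (simp add: le_less_trans)

lemma nnconv_quadratic_sech:
  assumes "a \<ge> 0" "d \<ge> 0"
  shows "nnconv (\<lambda>t. ennreal ((a * t\<^sup>2 + d) / cosh t)) esech s
    = ennreal ((a * s\<^sup>2 / 3 + a * pi\<^sup>2 / 12 + d) * csinh s)"
  using assms unfolding nn_integral_quadratic_sech_sech[OF assms, symmetric] nnconv_def esech_def
  by (simp add: ennreal_mult[symmetric])

lemma sechc_1: "sechc (Suc 0) s = ennreal (csinh s)"
proof -
  have "esech = (\<lambda>t. ennreal ((0 * t\<^sup>2 + 1) / cosh t))"
    by (simp add: esech_def fun_eq_iff)
  then show ?thesis
    using nnconv_quadratic_sech[of 0 1 s] by simp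
qed

text \<open>The weight \<open>2 t\<close> changes sign; it is written as \<open>(t + 1)\<^sup>2 - t\<^sup>2 - 1\<close> to reduce to nonnegative weights.\<close>

lemma has_bochner_integral_linear_tanh_sum:
  fixes s :: real
  assumes "s \<ge> 0"
  shows "has_bochner_integral lborel (\<lambda>t. 2 * t * (tanh t + tanh (s - t))) (2 * s\<^sup>2)"
proof -
  have *: "has_bochner_integral lborel (\<lambda>t. (a * t\<^sup>2 + 2 * b * t + d) * (tanh t + tanh (s - t)))
     (2 * (a * s ^ 3 / 3 + b * s\<^sup>2 + d * s) + a * pi\<^sup>2 / 6 * s)"
    if w: "\<And>t. a * t\<^sup>2 + 2 * b * t + d \<ge> 0" and "a \<ge> 0" "b \<ge> 0" "d \<ge> 0" for a b d :: real
  proof (rule has_bochner_integral_nn_integral)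
    show "AE t in lborel. 0 \<le> (a * t\<^sup>2 + 2 * b * t + d) * (tanh t + tanh (s - t))"
      using w assms unfolding tanh_sum_eq by (intro AE_I2 mult_nonneg_nonneg divide_nonneg_nonneg) auto
  qed (use that assms nn_integral_quadratic_tanh_sum[OF w] in auto)
  have "has_bochner_integral lborel
     (\<lambda>t. (1 * t\<^sup>2 + 2 * 1 * t + 1) * (tanh t + tanh (s - t)) - (1 * t\<^sup>2 + 2 * 0 * t + 0) * (tanh t + tanh (s - t))
        - (0 * t\<^sup>2 + 2 * 0 * t + 1) * (tanh t + tanh (s - t)))
     ((2 * (1 * s ^ 3 / 3 + 1 * s\<^sup>2 + 1 * s) + 1 * pi\<^sup>2 / 6 * s) - (2 * (1 * s ^ 3 / 3 + 0 * s\<^sup>2 + 0 * s) + 1 * pi\<^sup>2 / 6 * s)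
       - (2 * (0 * s ^ 3 / 3 + 0 * s\<^sup>2 + 1 * s) + 0 * pi\<^sup>2 / 6 * s))"
  proof (intro has_bochner_integral_diff *)
    fix t :: real
    show "1 * t\<^sup>2 + 2 * 1 * t + 1 \<ge> 0"
      using zero_le_power2[of "t + 1"] by (simp add: power2_sum)
  qed auto
  then show ?thesis
    by (simp add: algebra_simps)
qed

text \<open>The threefold power is determined up to its value \<open>c\<close> at 0. Multiplied by
  \<open>cosh s\<close>, its integrand differs from the one at \<open>s = 0\<close> by
  \<open>2 t (tanh t + tanh (s - t))\<close>, whose integral is \<open>2 s^2\<close>.\<close>

lemma sechc_2_aux:
  assumes c: "sechc (Suc (Suc 0)) 0 = ennreal c" "c \<ge> 0"
  shows "sechc (Suc (Suc 0)) s = ennreal ((2 * s\<^sup>2 + c) / cosh s)"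
proof -
  have eq: "sechc (Suc (Suc 0)) s = (\<integral>\<^sup>+t. ennreal (csinh t / cosh (s - t)) \<partial>lborel)" for s
    unfolding sechc.simps(2)[of "Suc 0"] nnconv_def sechc_1 esech_def
    by (simp add: ennreal_mult[symmetric] csinh_nonneg)
  have bi: "has_bochner_integral lborel (\<lambda>t. csinh t / cosh t) c"
    using c eq[of 0] by (intro has_bochner_integral_nn_integral) (auto simp: csinh_nonneg)
  have pos: "sechc (Suc (Suc 0)) s = ennreal ((2 * s\<^sup>2 + c) / cosh s)" if "s \<ge> 0" for s
  proof -
    \<comment> \<open>Since \<open>csinh t * sinh t = 2 t\<close>, this is \<open>csinh t\<close>
      times the identity \<open>cosh s / cosh (s - t) = 1 / cosh t + sinh t (tanh t + tanh (s -
      t))\<close>, a form of the addition theorem for \<open>cosh\<close>.\<close>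
    have pw: "csinh t / cosh t + 2 * t * (tanh t + tanh (s - t)) = cosh s * (csinh t / cosh (s - t))" for t
    proof (cases "t = 0")
      case False
      have "cosh s = cosh t * cosh (s - t) + sinh t * sinh (s - t)"
        using cosh_add[of t "s - t"] by simp
      moreover have "cosh t * cosh t = 1 + sinh t * sinh t"
        using cosh_square_eq[of t] by (simp add: power2_eq_square)
      then have "1 / cosh t + sinh t * tanh t = cosh t"
        by (simp add: tanh_def add_divide_distrib[symmetric] nonzero_divide_eq_eq)
      ultimately have "1 / cosh t + sinh t * (tanh t + tanh (s - t)) = cosh s / cosh (s - t)"
        by (simp add: distrib_left add.assoc[symmetric]) (simp add: tanh_def add_divide_distrib)
      then have "2 * t / sinh t * (1 / cosh t + sinh t * (tanh t + tanh (s - t))) = 2 * t / sinh t * (cosh s / cosh (s - t))"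
        by (rule arg_cong)
      then show ?thesis
        using False by (simp add: csinh_def distrib_left mult_ac)
    qed (simp add: csinh_def)
    have "has_bochner_integral lborel (\<lambda>t. cosh s * (csinh t / cosh (s - t))) (c + 2 * s\<^sup>2)"
      using has_bochner_integral_add[OF bi has_bochner_integral_linear_tanh_sum[OF that]]
      unfolding pw .
    then have "(\<integral>\<^sup>+t. ennreal (cosh s * (csinh t / cosh (s - t))) \<partial>lborel) = ennreal (c + 2 * s\<^sup>2)"
      by (subst nn_integral_eq_integral) (auto simp: has_bochner_integral_iff csinh_nonneg)
    then have "ennreal (cosh s) * sechc (Suc (Suc 0)) s = ennreal (2 * s\<^sup>2 + c)"
      unfolding eq by (subst nn_integral_cmult[symmetric]) (auto simp: ennreal_mult[symmetric] csinh_nonneg add.commute)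
    then show ?thesis
      by (rule ennreal_mult_eq_imp_divide) (use c in auto)
  qed
  show ?thesis
    using pos[of s] pos[of "- s"] sechc_minus[of "Suc (Suc 0)" s] by (cases "s \<ge> 0") auto
qed

text \<open>The threefold power is an even quadratic over \<open>cosh\<close>, so convolving once
  more falls under \<open>nnconv_quadratic_sech\<close> with \<open>a = 2\<close> and
  \<open>d = c\<close>.\<close>

lemma sechc_3_aux:
  assumes c: "sechc (Suc (Suc 0)) 0 = ennreal c" "c \<ge> 0"
  shows "sechc (Suc (Suc (Suc 0))) s = ennreal ((2 * s\<^sup>2 / 3 + pi\<^sup>2 / 6 + c) * csinh s)"
proof -
  have "sechc (Suc (Suc 0)) = (\<lambda>s. ennreal ((2 * s\<^sup>2 + c) / cosh s))"
    using sechc_2_aux[OF c] by auto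
  then show ?thesis
    using nnconv_quadratic_sech[of 2 c s] c(2)
    by (subst sechc.simps) simp
qed

text \<open>The constant is found by evaluating the fourth convolution power at 0 in two ways,
  as \<open>q\<^sub>3 * q\<^sub>1\<close> and as \<open>q\<^sub>2 * q\<^sub>2\<close>.\<close>

lemma sechc_2_0: "sechc (Suc (Suc 0)) 0 = ennreal (pi\<^sup>2 / 2)"
proof -
  obtain c where c: "sechc (Suc (Suc 0)) 0 = ennreal c" "c \<ge> 0"
    using sechc_finite[of "Suc (Suc 0)" 0] by (cases "sechc (Suc (Suc 0)) 0") auto
  have "sechc (Suc (Suc (Suc 0))) 0 = nnconv (sechc (Suc 0)) (sechc (Suc 0)) 0"
    by (simp add: nnconv_sechc del: sechc.simps)
  \<comment> \<open>Evenness of \<open>csinh\<close> turns the product into a square. At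
    \<open>t = 0\<close> the left side is 4 while the right side is 0 by division by zero, so
    equality is only almost everywhere.\<close>
  also have "\<dots> = (\<integral>\<^sup>+t. 4 * ennreal (t\<^sup>2 / (sinh t)\<^sup>2) \<partial>lborel)"
    unfolding nnconv_def sechc_1
  proof (intro nn_integral_cong_AE AE_I[where N = "{0}"] subsetI, rule ccontr)
    fix t assume t: "t \<in> {t \<in> space lborel. \<not> ennreal (csinh t) * ennreal (csinh (0 - t)) = 4 * ennreal (t\<^sup>2 / (sinh t)\<^sup>2)}" "t \<notin> {0}"
    then have "csinh t * csinh t = 4 * (t\<^sup>2 / (sinh t)\<^sup>2)"
      by (simp add: csinh_def power2_eq_square)
    then have "ennreal (csinh t) * ennreal (csinh t) = ennreal (4 * (t\<^sup>2 / (sinh t)\<^sup>2))"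
      by (simp add: csinh_nonneg flip: ennreal_mult)
    also have "\<dots> = ennreal 4 * ennreal (t\<^sup>2 / (sinh t)\<^sup>2)"
      by (rule ennreal_mult) auto
    finally show False
      using t by simp
  qed auto
  also have "\<dots> = ennreal (4 * (pi\<^sup>2 / 3))"
    by (subst nn_integral_cmult) (simp_all add: nn_integral_square_div_sinh_square ennreal_mult[symmetric] flip: ennreal_numeral)
  finally have "ennreal ((pi\<^sup>2 / 6 + c) * 2) = ennreal (4 * (pi\<^sup>2 / 3))"
    using sechc_3_aux[OF c, of 0] by (simp add: csinh_def del: sechc.simps)
  then have "(pi\<^sup>2 / 6 + c) * 2 = 4 * (pi\<^sup>2 / 3)"
    using c(2) by (subst (asm) ennreal_inj) auto
  then have "c = pi\<^sup>2 / 2"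
    by simp
  then show ?thesis
    using c(1) by (simp only:)
qed

lemma sechc_2: "sechc (Suc (Suc 0)) s = ennreal ((2 * s\<^sup>2 + pi\<^sup>2 / 2) / cosh s)"
  by (rule sechc_2_aux[OF sechc_2_0]) simp

lemma sechc_3: "sechc (Suc (Suc (Suc 0))) s = ennreal ((2 * s\<^sup>2 / 3 + pi\<^sup>2 / 6 + pi\<^sup>2 / 2) * csinh s)"
  by (rule sechc_3_aux[OF sechc_2_0]) simp

section \<open>The recurrence in the order of the convolution power\<close>

lemma ennreal_linear_eq_iff:
  assumes "p \<ge> 0" "y \<ge> 0" "a \<ge> 0" "q \<ge> 0" "z \<ge> 0"
  shows "ennreal p * ennreal y + 4 * ennreal a = ennreal q * ennreal z \<longleftrightarrow> p * y + 4 * a = q * z"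
proof -
  have "ennreal p * ennreal y + 4 * ennreal a = ennreal (p * y + 4 * a)"
    using assms by (simp add: ennreal_mult)
  moreover have "ennreal q * ennreal z = ennreal (q * z)"
    using assms by (simp add: ennreal_mult)
  ultimately show ?thesis
    using assms by (simp del: ennreal_plus)
qed

text \<open>In terms of the order \<open>N = n + 1\<close> this is
  \<open>N^2 pi^2 q(N) + 4 D q(N) = N (N + 1) q(N + 2)\<close>. Its Fourier counterpart is that
  \<open>sech^N\<close> has second derivative \<open>N^2 sech^N - N (N + 1) sech^(N + 2)\<close>;
  the proof below stays with convolutions.\<close>

definition sechc_rec :: "nat \<Rightarrow> bool" where
  "sechc_rec n \<longleftrightarrow> (\<forall>s. ennreal ((real n + 1)\<^sup>2 * pi\<^sup>2) * sechc n s + 4 * sqw (sechc n) s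
     = ennreal ((real n + 1) * (real n + 2)) * sechc (Suc (Suc n)) s)"

lemma sechc_rec_0: "sechc_rec 0"
  unfolding sechc_rec_def
proof
  fix s
  have "pi\<^sup>2 * (1 / cosh s) + 4 * (s\<^sup>2 * (1 / cosh s)) = 2 * ((2 * s\<^sup>2 + pi\<^sup>2 / 2) / cosh s)"
    by (simp add: field_simps)
  then show "ennreal ((real 0 + 1)\<^sup>2 * pi\<^sup>2) * sechc 0 s + 4 * sqw (sechc 0) s
     = ennreal ((real 0 + 1) * (real 0 + 2)) * sechc (Suc (Suc 0)) s"
    unfolding sechc_2 sqw_def sechc.simps(1) esech_def
    by (subst ennreal_mult[of "s\<^sup>2", symmetric], simp, simp, subst ennreal_linear_eq_iff) simp_all
qed

lemma sechc_rec_1: "sechc_rec (Suc 0)"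
  unfolding sechc_rec_def
proof
  fix s
  have "4 * pi\<^sup>2 * csinh s + 4 * (s\<^sup>2 * csinh s) = 6 * ((2 * s\<^sup>2 / 3 + pi\<^sup>2 / 6 + pi\<^sup>2 / 2) * csinh s)"
    by (simp add: field_simps)
  then show "ennreal ((real (Suc 0) + 1)\<^sup>2 * pi\<^sup>2) * sechc (Suc 0) s + 4 * sqw (sechc (Suc 0)) s
     = ennreal ((real (Suc 0) + 1) * (real (Suc 0) + 2)) * sechc (Suc (Suc (Suc 0))) s"
    unfolding sechc_3 sqw_def sechc_1
    by (subst ennreal_mult[of "s\<^sup>2", symmetric], simp, simp add: csinh_nonneg, subst ennreal_linear_eq_iff)
       (simp_all add: csinh_nonneg)
qed

text \<open>Convolving the recurrence with a further power expresses the mixed term, in which only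
  one factor carries the weight, through unweighted powers.\<close>

lemma sechc_rec_nnconv:
  assumes "sechc_rec n"
  shows "ennreal ((real n + 1)\<^sup>2 * pi\<^sup>2) * sechc (Suc (n + k)) s + 4 * nnconv (sqw (sechc n)) (sechc k) s
     = ennreal ((real n + 1) * (real n + 2)) * sechc (n + k + 3) s"
proof -
  have "nnconv (\<lambda>s. ennreal ((real n + 1)\<^sup>2 * pi\<^sup>2) * sechc n s + 4 * sqw (sechc n) s) (sechc k) s
     = nnconv (\<lambda>s. ennreal ((real n + 1) * (real n + 2)) * sechc (Suc (Suc n)) s) (sechc k) s"
    using assms by (simp only: sechc_rec_def)
  then show ?thesis
    by (subst (asm) nnconv_lincomb_left, measurable, subst (asm) nnconv_cmult_left, measurable)
       (simp only: nnconv_sechc, simp add: numeral_3_eq_3 del: sechc.simps)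
qed

text \<open>Apply \<open>sqw_nnconv3\<close> to \<open>sechc n\<close> and two copies of
  \<open>sech\<close>. Every term but the fully weighted one is a power carrying the weight,
  convolved with another power; the recurrences at \<open>n\<close>, \<open>0\<close>,
  \<open>Suc n\<close> and \<open>1\<close> evaluate these.\<close>

lemma sechc_rec_step:
  assumes n: "sechc_rec n" and Suc_n: "sechc_rec (Suc n)"
  shows "sechc_rec (Suc (Suc n))"
  unfolding sechc_rec_def
proof
  fix s
  define A0 where "A0 = nnconv (sqw (sechc n)) (sechc (Suc 0)) s"
  define A1 where "A1 = nnconv (sqw (sechc 0)) (sechc (Suc n)) s"
  define A2 where "A2 = nnconv (sqw (sechc (Suc n))) (sechc 0) s"
  define A3 where "A3 = nnconv (sqw (sechc (Suc 0))) (sechc n) s"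
  define X where "X = sqw (sechc (Suc (Suc n))) s"
  define Y where "Y = sechc (Suc (Suc n)) s"
  define Z where "Z = sechc (Suc (Suc (Suc (Suc n)))) s"
  have 0: "nnconv (nnconv (sqw (sechc n)) esech) esech s = A0"
    by (simp add: A0_def nnconv_assoc)
  have 1: "nnconv (nnconv (sechc n) esech) (sqw esech) s = A1"
    by (simp add: A1_def nnconv_commute[of "nnconv (sechc n) esech"])
  have 2: "nnconv (nnconv (sechc n) (sqw esech)) esech s = A1"
    by (simp add: A1_def nnconv_commute[of "sechc n" "sqw esech"] nnconv_assoc)
  have 3: "nnconv (sqw (nnconv (sechc n) esech)) esech s = A2"
    by (simp add: A2_def)
  have 4: "nnconv (sechc n) (sqw (nnconv esech esech)) s = A3"
    by (simp add: A3_def nnconv_commute[of "sechc n"])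
  \<comment> \<open>Two of the three factors coincide, hence \<open>A1\<close> and \<open>A2\<close>
    occur twice.\<close>
  have eqT: "X + A0 + A1 + A1 = A2 + A3 + A2"
    using sqw_nnconv3[of "sechc n" esech esech s] unfolding 0 1 2 3 4 X_def by simp
  have eq0: "ennreal ((real n + 1)\<^sup>2 * pi\<^sup>2) * Y + 4 * A0 = ennreal ((real n + 1) * (real n + 2)) * Z"
    using sechc_rec_nnconv[OF n, of "Suc 0" s]
    by (simp add: A0_def Y_def Z_def numeral_3_eq_3 del: sechc.simps)
  have eq1: "ennreal (pi\<^sup>2) * Y + 4 * A1 = ennreal 2 * Z"
    using sechc_rec_nnconv[OF sechc_rec_0, of "Suc n" s]
    by (simp add: A1_def Y_def Z_def numeral_3_eq_3 del: sechc.simps)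
  have eq2: "ennreal ((real n + 2)\<^sup>2 * pi\<^sup>2) * Y + 4 * A2 = ennreal ((real n + 2) * (real n + 3)) * Z"
    using sechc_rec_nnconv[OF Suc_n, of 0 s]
    by (simp add: A2_def Y_def Z_def numeral_3_eq_3 add_ac del: sechc.simps)
  have eq3: "ennreal (4 * pi\<^sup>2) * Y + 4 * A3 = ennreal 6 * Z"
    using sechc_rec_nnconv[OF sechc_rec_1, of n s]
    by (simp add: A3_def Y_def Z_def numeral_3_eq_3 del: sechc.simps)
  obtain y where y: "Y = ennreal y" "y \<ge> 0"
    using sechc_finite[of "Suc (Suc n)" s] unfolding Y_def[symmetric] by (cases Y) auto
  obtain z where z: "Z = ennreal z" "z \<ge> 0"
    using sechc_finite[of "Suc (Suc (Suc (Suc n)))" s] unfolding Z_def[symmetric] by (cases Z) auto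
  define x where "x = s\<^sup>2 * y"
  have x: "X = ennreal x" "x \<ge> 0"
    using y unfolding X_def sqw_def Y_def[symmetric] x_def by (simp_all add: ennreal_mult)
  \<comment> \<open>Each mixed term is dominated by a finite multiple of \<open>Z\<close>, hence
    finite. This permits the passage to real equations, where subtraction is available.\<close>
  have fin: "\<exists>a\<ge>0. A = ennreal a" if "B + 4 * A = ennreal b * Z" for A B b
  proof -
    have "ennreal b * Z < \<infinity>"
      by (simp add: z ennreal_mult_less_top)
    then show ?thesis
      unfolding that[symmetric] by (cases A) auto
  qed
  obtain a0 a1 a2 a3 where a: "A0 = ennreal a0" "a0 \<ge> 0" "A1 = ennreal a1" "a1 \<ge> 0"
      "A2 = ennreal a2" "a2 \<ge> 0" "A3 = ennreal a3" "a3 \<ge> 0"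
    using fin[OF eq0] fin[OF eq1] fin[OF eq2] fin[OF eq3] by blast
  have T: "x + a0 + a1 + a1 = a2 + a3 + a2"
    using eqT x a by (simp flip: ennreal_plus)
  have r: "(real n + 1)\<^sup>2 * pi\<^sup>2 * y + 4 * a0 = (real n + 1) * (real n + 2) * z"
    "pi\<^sup>2 * y + 4 * a1 = 2 * z"
    "(real n + 2)\<^sup>2 * pi\<^sup>2 * y + 4 * a2 = (real n + 2) * (real n + 3) * z"
    "4 * pi\<^sup>2 * y + 4 * a3 = 6 * z"
    using eq0 eq1 eq2 eq3 a y z by (simp_all only: ennreal_linear_eq_iff mult_nonneg_nonneg zero_le_power2
        add_nonneg_nonneg of_nat_0_le_iff zero_le_one zero_le_numeral)
  \<comment> \<open>Take four times \<open>T\<close> and eliminate the mixed terms. The coefficients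
    are \<open>2 (n+2)(n+3) + 6 - (n+1)(n+2) - 4 = (n+3)(n+4)\<close> and
    \<open>2 (n+2)^2 + 4 - (n+1)^2 - 2 = (n+3)^2\<close>.\<close>
  have "(real n + 3)\<^sup>2 * pi\<^sup>2 * y + 4 * x = (real n + 3) * (real n + 4) * z"
    using T r by algebra
  then show "ennreal ((real (Suc (Suc n)) + 1)\<^sup>2 * pi\<^sup>2) * sechc (Suc (Suc n)) s + 4 * sqw (sechc (Suc (Suc n))) s
     = ennreal ((real (Suc (Suc n)) + 1) * (real (Suc (Suc n)) + 2)) * sechc (Suc (Suc (Suc (Suc n)))) s"
    unfolding X_def[symmetric] Y_def[symmetric] Z_def[symmetric] x(1) y(1) z(1)
    by (subst ennreal_linear_eq_iff) (use x y z in \<open>auto simp: add_ac\<close>)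
qed

lemma sechc_rec: "sechc_rec n"
proof -
  \<comment> \<open>The step needs two consecutive instances, so the induction carries a
    pair.\<close>
  have "sechc_rec n \<and> sechc_rec (Suc n)"
    by (induction n) (auto intro: sechc_rec_0 sechc_rec_1 sechc_rec_step)
  then show ?thesis ..
qed

section \<open>Reduction of the cyclic integral\<close>

text \<open>Substitution on compact intervals followed by monotone convergence, as the exponential
  maps an exhaustion of the line to one of the positive half-line. The factor 2 in the exponent lets
  sums of two coordinates factor through \<open>cosh\<close>.\<close>

lemma nn_integral_exp_substitution:
  fixes f :: "real \<Rightarrow> ennreal" and y :: real
  assumes [measurable]: "f \<in> borel_measurable borel" and y: "y > 0"
  shows "(\<integral>\<^sup>+u. indicator {0<..} u * f u \<partial>lborel) = (\<integral>\<^sup>+t. ennreal (2 * y * exp (2 * t)) * f (y * exp (2 * t)) \<partial>lborel)"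
proof -
  define g where "g t = y * exp (2 * t)" for t :: real
  \<comment> \<open>The shift by 1 keeps the interval nondegenerate for
    \<open>k = 0\<close>.\<close>
  define a where "a k = real k + 1" for k :: nat
  have g_mono: "g s \<le> g t \<longleftrightarrow> s \<le> t" for s t
    using y by (simp add: g_def)
  have mono: "incseq (\<lambda>k. {g (- a k)..g (a k)})" "incseq (\<lambda>k. {- a k..a k})"
    unfolding incseq_def atLeastatMost_subset_iff g_mono by (simp_all add: a_def)
  have Un: "(\<Union>k. {- a k..a k}) = UNIV"
  proof (intro UNIV_eq_I[symmetric])
    fix t :: real
    obtain k where "real k > \<bar>t\<bar>" using reals_Archimedean2 by blast
    then show "t \<in> (\<Union>k. {- a k..a k})" by (intro UN_I[of k]) (auto simp: a_def)
  qed
  have Un_g: "(\<Union>k. {g (- a k)..g (a k)}) = {0<..}"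
  proof (intro equalityI subsetI)
    fix u assume "u \<in> (\<Union>k. {g (- a k)..g (a k)})"
    then obtain k where "g (- a k) \<le> u" by auto
    moreover have "g (- a k) > 0" using y by (simp add: g_def)
    ultimately show "u \<in> {0<..}" by simp
  next
    fix u :: real assume "u \<in> {0<..}"
    then have "u = g (ln (u / y) / 2)"
      using y by (simp add: g_def)
    moreover obtain k where "ln (u / y) / 2 \<in> {- a k..a k}" using Un by blast
    ultimately show "u \<in> (\<Union>k. {g (- a k)..g (a k)})"
      using g_mono by (metis UN_I UNIV_I atLeastAtMost_iff)
  qed
  have SUP_ind: "(\<integral>\<^sup>+u. h u * indicator (\<Union>k. A k) u \<partial>lborel) = (SUP k. \<integral>\<^sup>+u. h u * indicator (A k) u \<partial>lborel)"
    if [measurable]: "h \<in> borel_measurable borel" "\<And>k. A k \<in> sets borel" and "incseq A" for h :: "real \<Rightarrow> ennreal" and A :: "nat \<Rightarrow> real set"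
  proof -
    have "(SUP k. \<integral>\<^sup>+u. h u * indicator (A k) u \<partial>lborel) = (\<integral>\<^sup>+u. (SUP k. h u * indicator (A k) u) \<partial>lborel)"
      using \<open>incseq A\<close> by (intro nn_integral_monotone_convergence_SUP[symmetric])
        (auto simp: incseq_def le_fun_def split: split_indicator)
    also have "\<dots> = (\<integral>\<^sup>+u. h u * indicator (\<Union>k. A k) u \<partial>lborel)"
    proof (rule nn_integral_cong)
      fix u
      show "(SUP k. h u * indicator (A k) u) = h u * indicator (\<Union>k. A k) u"
      proof (cases "u \<in> (\<Union>k. A k)")
        case True
        then obtain k where "u \<in> A k" by blast
        then have "h u \<le> (SUP k. h u * indicator (A k) u)"
          by (intro SUP_upper2[of k]) auto
        then show ?thesis
          using True by (intro antisym SUP_least) (auto split: split_indicator)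
      qed simp
    qed
    finally show ?thesis by simp
  qed
  have "(\<integral>\<^sup>+u. f u * indicator (\<Union>k. {g (- a k)..g (a k)}) u \<partial>lborel)
      = (SUP k. \<integral>\<^sup>+u. f u * indicator {g (- a k)..g (a k)} u \<partial>lborel)"
    by (intro SUP_ind mono) auto
  also have "\<dots> = (SUP k. \<integral>\<^sup>+t. f (g t) * ennreal (2 * g t) * indicator {- a k..a k} t \<partial>lborel)"
  proof (intro SUP_cong refl nn_integral_substitution_aux)
    fix k
    show "(g has_real_derivative 2 * g x) (at x)" for x
      unfolding g_def by (auto intro!: derivative_eq_intros)
    show "continuous_on {- a k..a k} (\<lambda>t. 2 * g t)"
      unfolding g_def by (intro continuous_intros)
  qed (use y in \<open>auto simp: g_def a_def\<close>)
  also have "\<dots> = (\<integral>\<^sup>+t. f (g t) * ennreal (2 * g t) * indicator (\<Union>k. {- a k..a k}) t \<partial>lborel)"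
    by (intro SUP_ind[symmetric] mono) (auto simp: g_def)
  finally show ?thesis
    unfolding Un Un_g by (simp add: g_def mult_ac)
qed

text \<open>Induction on the index set: the one-dimensional rule \<open>subst\<close> treats the new
  coordinate and the induction hypothesis the slices \<open>F (x(i := y))\<close>, so
  \<open>F\<close> must stay arbitrary.\<close>

lemma nn_integral_PiM_substitution:
  fixes \<phi> :: "real \<Rightarrow> real" and \<rho> :: "real \<Rightarrow> ennreal" and I :: "nat set"
  assumes "finite I" and [measurable]: "\<phi> \<in> borel_measurable borel" "\<rho> \<in> borel_measurable borel"
    and subst: "\<And>f :: real \<Rightarrow> ennreal. f \<in> borel_measurable borel \<Longrightarrow>
      (\<integral>\<^sup>+u. indicator S u * f u \<partial>lborel) = (\<integral>\<^sup>+t. \<rho> t * f (\<phi> t) \<partial>lborel)"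
    and S: "S \<in> sets borel"
    and "F \<in> borel_measurable (PiM I (\<lambda>_. lborel))"
  shows "(\<integral>\<^sup>+u. (\<Prod>j\<in>I. indicator S (u j)) * F u \<partial>PiM I (\<lambda>_. lborel))
    = (\<integral>\<^sup>+t. (\<Prod>j\<in>I. \<rho> (t j)) * F (\<lambda>j\<in>I. \<phi> (t j)) \<partial>PiM I (\<lambda>_. lborel))"
  using assms(1,6)
proof (induction I arbitrary: F rule: finite_induct)
  case empty
  show ?case by (simp add: restrict_def PiM_empty nn_integral_count_space_finite)
next
  case (insert i I)
  note S[measurable] insert.prems[measurable]
  interpret product_sigma_finite "\<lambda>_ :: nat. lborel :: real measure" ..
  interpret I: finite_product_sigma_finite "\<lambda>_ :: nat. lborel :: real measure" I
    by standard (fact insert.hyps)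
  have upd: "(\<lambda>(x, y). x(i := y)) \<in> PiM I (\<lambda>_. lborel :: real measure) \<Otimes>\<^sub>M borel \<rightarrow>\<^sub>M PiM (insert i I) (\<lambda>_. lborel)"
    using measurable_add_dim[of i I "\<lambda>_. lborel :: real measure"]
    by (simp add: measurable_cong_sets[OF sets_pair_measure_cong[OF refl sets_lborel] refl])
  have [measurable]: "(\<lambda>x. F ((f x)(i := h x))) \<in> borel_measurable M"
    if [measurable]: "f \<in> M \<rightarrow>\<^sub>M PiM I (\<lambda>_. lborel)" "h \<in> borel_measurable M" for f h and M :: "'b measure"
    using measurable_compose[OF measurable_compose[OF measurable_Pair[OF that] upd] insert.prems] by simp
  have [measurable]: "(\<lambda>x. (\<Prod>j\<in>J. indicator S (x j)) :: ennreal) \<in> borel_measurable (PiM J (\<lambda>_. lborel))"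
    "(\<lambda>x. \<Prod>j\<in>J. \<rho> (x j)) \<in> borel_measurable (PiM J (\<lambda>_. lborel))"
    "(\<lambda>x. \<lambda>j\<in>J. \<phi> (x j)) \<in> PiM J (\<lambda>_. lborel) \<rightarrow>\<^sub>M PiM J (\<lambda>_. lborel)" for J :: "nat set"
    by measurable
  \<comment> \<open>The slice integral after the old coordinates have been substituted, with the new
    one still untouched.\<close>
  define G where "G y = (\<integral>\<^sup>+x. (\<Prod>j\<in>I. \<rho> (x j)) * F ((\<lambda>j\<in>I. \<phi> (x j))(i := y)) \<partial>PiM I (\<lambda>_. lborel))" for y
  have [measurable]: "G \<in> borel_measurable borel"
    unfolding G_def by measurable
  have prod_upd: "(\<Prod>j\<in>insert i I. h ((x(i := y)) j)) = h y * (\<Prod>j\<in>I. h (x j))"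
    for h :: "real \<Rightarrow> ennreal" and x y
    using insert.hyps by (subst prod.insert) (auto intro!: arg_cong[where f = "(*) _"] prod.cong)
  have restrict_upd: "(\<lambda>j\<in>insert i I. \<phi> ((x(i := y)) j)) = (\<lambda>j\<in>I. \<phi> (x j))(i := \<phi> y)" for x y
    using insert.hyps by (auto simp: fun_eq_iff)
  have "(\<integral>\<^sup>+u. (\<Prod>j\<in>insert i I. indicator S (u j)) * F u \<partial>PiM (insert i I) (\<lambda>_. lborel))
      = (\<integral>\<^sup>+y. \<integral>\<^sup>+x. indicator S y * ((\<Prod>j\<in>I. indicator S (x j)) * F (x(i := y))) \<partial>PiM I (\<lambda>_. lborel) \<partial>lborel)"
    using insert.hyps
    by (subst product_nn_integral_insert_rev) (auto simp only: prod_upd mult.assoc intro!: borel_measurable_times, measurable)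
  also have "\<dots> = (\<integral>\<^sup>+y. indicator S y * G y \<partial>lborel)"
  proof (rule nn_integral_cong)
    fix y
    show "(\<integral>\<^sup>+x. indicator S y * ((\<Prod>j\<in>I. indicator S (x j)) * F (x(i := y))) \<partial>PiM I (\<lambda>_. lborel)) = indicator S y * G y"
      unfolding G_def by (subst insert.IH[symmetric], measurable, subst nn_integral_cmult) auto
  qed
  also have "\<dots> = (\<integral>\<^sup>+y. \<rho> y * G (\<phi> y) \<partial>lborel)"
    by (rule subst) measurable
  also have "\<dots> = (\<integral>\<^sup>+y. \<integral>\<^sup>+x. \<rho> y * ((\<Prod>j\<in>I. \<rho> (x j)) * F ((\<lambda>j\<in>I. \<phi> (x j))(i := \<phi> y))) \<partial>PiM I (\<lambda>_. lborel) \<partial>lborel)"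
    unfolding G_def by (intro nn_integral_cong nn_integral_cmult[symmetric]) measurable
  also have "\<dots> = (\<integral>\<^sup>+t. (\<Prod>j\<in>insert i I. \<rho> (t j)) * F (\<lambda>j\<in>insert i I. \<phi> (t j)) \<partial>PiM (insert i I) (\<lambda>_. lborel))"
    using insert.hyps
    by (subst product_nn_integral_insert_rev) (auto simp only: prod_upd restrict_upd mult.assoc, measurable)
  finally show ?case .
qed

text \<open>Product of \<open>sech\<close> over the edges of the path from 0 through
  \<open>\<tau> 0\<close> up to \<open>\<tau> m\<close>. If \<open>\<tau> m = 0\<close> the path
  closes up to the cycle of the original integral.\<close>

definition sech_chain :: "nat \<Rightarrow> (nat \<Rightarrow> real) \<Rightarrow> real" where
  "sech_chain m \<tau> = 1 / (cosh (\<tau> 0) * (\<Prod>j<m. cosh (\<tau> j - \<tau> (Suc j))))"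

lemma sech_chain_nonneg: "sech_chain m \<tau> \<ge> 0"
  unfolding sech_chain_def by (intro divide_nonneg_nonneg mult_nonneg_nonneg prod_nonneg) auto

lemma measurable_upd_last:
  fixes h :: "'a \<Rightarrow> real"
  assumes "j \<le> (m :: nat)" "h \<in> borel_measurable M" "f \<in> M \<rightarrow>\<^sub>M PiM {..<m} (\<lambda>_. lborel)"
  shows "(\<lambda>x. ((f x)(m := h x)) j) \<in> borel_measurable M"
proof (cases "j = m")
  case False
  then have "(\<lambda>x. x j) \<in> borel_measurable (PiM {..<m} (\<lambda>_. lborel :: real measure))"
    using measurable_component_singleton[of j "{..<m}" "\<lambda>_. lborel :: real measure"] assms(1) by simp
  from measurable_compose[OF assms(3) this] show ?thesis
    using False by simp
qed (use assms in simp)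

lemma measurable_sech_chain:
  fixes h :: "'a \<Rightarrow> real"
  assumes [measurable]: "h \<in> borel_measurable M" "f \<in> M \<rightarrow>\<^sub>M PiM {..<m} (\<lambda>_. lborel)"
  shows "(\<lambda>x. sech_chain m ((f x)(m := h x))) \<in> borel_measurable M"
proof -
  have [measurable]: "(\<lambda>x. ((f x)(m := h x)) j) \<in> borel_measurable M" if "j \<le> m" for j
    using that assms by (rule measurable_upd_last)
  have "(\<lambda>x. \<Prod>j<m. cosh (((f x)(m := h x)) j - ((f x)(m := h x)) (Suc j))) \<in> borel_measurable M"
    by (intro borel_measurable_prod borel_measurable_cosh_real borel_measurable_diff measurable_upd_last assms) auto
  moreover have "(\<lambda>x. cosh (((f x)(m := h x)) 0)) \<in> borel_measurable M"
    by (intro borel_measurable_cosh_real measurable_upd_last assms) auto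
  ultimately show ?thesis
    unfolding sech_chain_def by (intro borel_measurable_divide borel_measurable_times borel_measurable_const)
qed

text \<open>Integrating out the interior vertices of the path produces one convolution per vertex;
  the last one, \<open>y\<close>, contributes the factor \<open>sech (b - y)\<close>.\<close>

lemma nn_integral_sech_chain:
  "(\<integral>\<^sup>+t. ennreal (sech_chain m (t(m := b))) \<partial>PiM {..<m} (\<lambda>_. lborel)) = sechc m b"
proof (induction m arbitrary: b)
  case 0
  show ?case
    by (simp add: PiM_empty nn_integral_count_space_finite sech_chain_def esech_def)
next
  case (Suc m)
  interpret product_sigma_finite "\<lambda>_ :: nat. lborel :: real measure" ..
  have chain_Suc: "sech_chain (Suc m) (x(m := y, Suc m := b)) = sech_chain m (x(m := y)) * (1 / cosh (b - y))"
    for x :: "nat \<Rightarrow> real" and y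
  proof -
    have "(\<Prod>j<m. cosh ((x(m := y, Suc m := b)) j - (x(m := y, Suc m := b)) (Suc j)))
        = (\<Prod>j<m. cosh ((x(m := y)) j - (x(m := y)) (Suc j)))"
      by (intro prod.cong) auto
    moreover have "cosh (y - b) = cosh (b - y)"
      using cosh_minus[of "b - y"] by simp
    ultimately show ?thesis
      unfolding sech_chain_def by simp
  qed
  note [measurable] = measurable_sech_chain
  have "(\<integral>\<^sup>+t. ennreal (sech_chain (Suc m) (t(Suc m := b))) \<partial>PiM {..<Suc m} (\<lambda>_. lborel))
      = (\<integral>\<^sup>+y. \<integral>\<^sup>+x. ennreal (sech_chain (Suc m) (x(m := y, Suc m := b))) \<partial>PiM {..<m} (\<lambda>_. lborel) \<partial>lborel)"
    unfolding lessThan_Suc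
    by (rule product_nn_integral_insert_rev)
       (auto simp flip: lessThan_Suc intro!: measurable_compose[OF _ measurable_ennreal] measurable_sech_chain)
  also have "\<dots> = (\<integral>\<^sup>+y. (\<integral>\<^sup>+x. ennreal (sech_chain m (x(m := y))) \<partial>PiM {..<m} (\<lambda>_. lborel)) * esech (b - y) \<partial>lborel)"
    unfolding chain_Suc esech_def
    by (subst nn_integral_multc[symmetric]) (auto simp: ennreal_mult[symmetric] sech_chain_nonneg)
  also have "\<dots> = sechc (Suc m) b"
    by (simp add: Suc nnconv_def)
  finally show ?case .
qed

section \<open>The cyclic denominator in exponential coordinates\<close>

lemma prod_exp_cyclic:
  fixes \<tau> :: "nat \<Rightarrow> real"
  shows "(\<Prod>j<m. exp (\<tau> j + \<tau> (Suc j))) * exp (\<tau> m + \<tau> 0) = (\<Prod>j<Suc m. exp (2 * \<tau> j))"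
proof (induction m)
  case (Suc m)
  have "(\<Prod>j<Suc m. exp (\<tau> j + \<tau> (Suc j))) * exp (\<tau> (Suc m) + \<tau> 0)
      = ((\<Prod>j<m. exp (\<tau> j + \<tau> (Suc j))) * exp (\<tau> m + \<tau> 0)) * exp (2 * \<tau> (Suc m))"
    by (simp add: exp_add[symmetric] mult.assoc)
  then show ?case
    unfolding Suc.IH by simp
qed simp

lemma sum_exp_eq_cosh:
  fixes y a b :: real
  shows "y * exp (2 * a) + y * exp (2 * b) = 2 * y * exp (a + b) * cosh (a - b)"
proof -
  have "2 * y * exp (a + b) * cosh (a - b) = y * (exp (a + b) * exp (a - b)) + y * (exp (a + b) * exp (- (a - b)))"
    unfolding cosh_field_def by (simp add: distrib_left)
  then show ?thesis
    by (simp add: mult_exp_exp)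
qed

text \<open>Each factor equals \<open>2 y exp (\<tau> j + \<tau> (j + 1)) cosh (\<tau> j - \<tau> (j
  + 1))\<close>, indices cyclic. Every vertex lies on two edges, so the exponentials collect to
  \<open>exp (2 * \<tau> j)\<close>, and the \<open>cosh\<close> factors form the reciprocal chain.
  With \<open>\<tau> m = 0\<close> the closing edge gives \<open>cosh (\<tau> 0)\<close>.\<close>

lemma prod_cyclic_exp:
  fixes \<tau> :: "nat \<Rightarrow> real" and y :: real
  assumes "\<tau> m = 0"
  shows "(\<Prod>j<Suc m. y * exp (2 * \<tau> j) + y * exp (2 * \<tau> ((j + 1) mod Suc m)))
    = (2 * y) ^ Suc m * (\<Prod>j<m. exp (2 * \<tau> j)) / sech_chain m \<tau>"
proof -
  have "(\<Prod>j<Suc m. y * exp (2 * \<tau> j) + y * exp (2 * \<tau> ((j + 1) mod Suc m)))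
      = (\<Prod>j<m. 2 * y * exp (\<tau> j + \<tau> (Suc j)) * cosh (\<tau> j - \<tau> (Suc j))) * (2 * y * exp (\<tau> m + \<tau> 0) * cosh (\<tau> m - \<tau> 0))"
    unfolding prod.lessThan_Suc sum_exp_eq_cosh by (auto intro!: arg_cong2[where f = "(*)"] prod.cong)
  also have "\<dots> = (2 * y) ^ Suc m * ((\<Prod>j<m. exp (\<tau> j + \<tau> (Suc j))) * exp (\<tau> m + \<tau> 0))
      * (cosh (\<tau> 0) * (\<Prod>j<m. cosh (\<tau> j - \<tau> (Suc j))))"
    by (simp add: prod.distrib assms mult_ac)
  also have "\<dots> = (2 * y) ^ Suc m * (\<Prod>j<m. exp (2 * \<tau> j)) / sech_chain m \<tau>"
    unfolding prod_exp_cyclic by (simp add: assms sech_chain_def)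
  finally show ?thesis .
qed

lemma nn_integral_exponential:
  fixes A :: real
  assumes "A > 0"
  shows "(\<integral>\<^sup>+y. indicator {0<..} y * ennreal (A * exp (- (A * y))) \<partial>lborel) = 1"
proof -
  have "(\<integral>\<^sup>+y. indicator {0<..} y * ennreal (A * exp (- (A * y))) \<partial>lborel)
      = (\<integral>\<^sup>+y. ennreal (A * exp (- (A * y))) * indicator {0..} y \<partial>lborel)"
    by (intro nn_integral_cong_AE AE_I[where N = "{0}"]) (auto split: split_indicator)
  also have "\<dots> = ennreal (0 - (- exp (- (A * 0))))"
  proof (rule nn_integral_FTC_atLeast)
    show "((\<lambda>y. - exp (- (A * y))) has_real_derivative A * exp (- (A * x))) (at x)" for x
      by (auto intro!: derivative_eq_intros)
    show "((\<lambda>y. - exp (- (A * y))) \<longlongrightarrow> 0) at_top"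
      using assms by real_asymp
  qed (use assms in auto)
  finally show ?thesis by simp
qed

lemma I_int_Suc:
  assumes m: "m > 0"
  shows "2 * I_int (Suc m) = sechc m 0"
proof -
  interpret product_sigma_finite "\<lambda>_ :: nat. lborel :: real measure" ..
  interpret M: finite_product_sigma_finite "\<lambda>_ :: nat. lborel :: real measure" "{..<m}"
    by standard simp
  interpret pair_sigma_finite "lborel :: real measure" "PiM {..<m} (\<lambda>_. lborel :: real measure)" ..
  define E where "E u = ennreal ((\<Sum>j<Suc m. u j) * exp (- (\<Sum>j<Suc m. u j)) / (\<Prod>j<Suc m. u j + u ((j + 1) mod Suc m)))"
    for u :: "nat \<Rightarrow> real"
  \<comment> \<open>The sum of all coordinates divided by \<open>y\<close>; the 1 comes from the
    last coordinate, \<open>y\<close> itself.\<close>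
  define A where "A t = 1 + (\<Sum>j<m. exp (2 * t j))" for t :: "nat \<Rightarrow> real"
  have A_pos: "A t > 0" for t
    unfolding A_def by (intro add_pos_nonneg sum_nonneg) auto
  have comp[measurable]: "(\<lambda>u. u j) \<in> borel_measurable (PiM {..<k} (\<lambda>_. lborel :: real measure))" if "j < k" for j k :: nat
    using measurable_component_singleton[of j "{..<k}" "\<lambda>_. lborel :: real measure"] that by simp
  have E[measurable]: "E \<in> borel_measurable (PiM {..<Suc m} (\<lambda>_. lborel))"
    unfolding E_def by (auto intro!: measurable_compose[OF _ measurable_ennreal] borel_measurable_divide
      borel_measurable_times borel_measurable_sum borel_measurable_prod borel_measurable_add comp
      measurable_compose[OF _ borel_measurable_exp] borel_measurable_uminus)
  have A[measurable]: "A \<in> borel_measurable (PiM {..<m} (\<lambda>_. lborel))"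
    unfolding A_def by measurable
  have E_upd[measurable]: "(\<lambda>x. E (x(m := y))) \<in> borel_measurable (PiM {..<m} (\<lambda>_. lborel))" for y
    by (intro measurable_compose[OF _ E] measurable_fun_upd[where J = "{..<m}"]) auto
  have chain[measurable]: "(\<lambda>t. sech_chain m (t(m := 0))) \<in> borel_measurable (PiM {..<m} (\<lambda>_. lborel))"
    by (rule measurable_sech_chain) auto
  \<comment> \<open>The Jacobian cancels the denominator up to a factor \<open>2 y\<close>. What
    remains is the exponential density in \<open>y\<close> with rate \<open>A t\<close>, times half
    the closed chain.\<close>
  have key: "(\<Prod>j<m. ennreal (2 * y * exp (2 * t j))) * E ((\<lambda>j\<in>{..<m}. y * exp (2 * t j))(m := y))
      = ennreal (A t * exp (- (A t * y))) * ennreal (sech_chain m (t(m := 0)) / 2)" if y: "y > 0" for y t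
  proof -
    define \<tau> where "\<tau> = t(m := 0)"
    have upd: "((\<lambda>j\<in>{..<m}. y * exp (2 * t j))(m := y)) j = y * exp (2 * \<tau> j)" if "j < Suc m" for j
      using that by (auto simp: \<tau>_def)
    have sum: "(\<Sum>j<Suc m. ((\<lambda>j\<in>{..<m}. y * exp (2 * t j))(m := y)) j) = y * A t"
      by (simp add: A_def distrib_left sum_distrib_left)
    have "(\<Prod>j<Suc m. ((\<lambda>j\<in>{..<m}. y * exp (2 * t j))(m := y)) j + ((\<lambda>j\<in>{..<m}. y * exp (2 * t j))(m := y)) ((j + 1) mod Suc m))
        = (\<Prod>j<Suc m. y * exp (2 * \<tau> j) + y * exp (2 * \<tau> ((j + 1) mod Suc m)))"
      by (intro prod.cong refl arg_cong2[where f = "(+)"] upd) auto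
    also have "\<dots> = (2 * y) ^ Suc m * (\<Prod>j<m. exp (2 * \<tau> j)) / sech_chain m \<tau>"
      by (rule prod_cyclic_exp) (simp add: \<tau>_def)
    also have "(\<Prod>j<m. exp (2 * \<tau> j)) = (\<Prod>j<m. exp (2 * t j))"
      by (intro prod.cong) (auto simp: \<tau>_def)
    finally have E_eq: "E ((\<lambda>j\<in>{..<m}. y * exp (2 * t j))(m := y))
        = ennreal (y * A t * exp (- (y * A t)) / ((2 * y) ^ Suc m * (\<Prod>j<m. exp (2 * t j)) / sech_chain m \<tau>))"
      unfolding E_def sum by (simp only:)
    have P: "(\<Prod>j<m. ennreal (2 * y * exp (2 * t j))) = ennreal ((2 * y) ^ m * (\<Prod>j<m. exp (2 * t j)))"
      using y by (subst prod_ennreal) (auto simp: prod.distrib)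
    define Q where "Q = (\<Prod>j<m. exp (2 * t j))"
    have Q: "Q > 0"
      unfolding Q_def by (intro prod_pos) auto
    have chain_pos: "sech_chain m \<tau> \<ge> 0"
      by (rule sech_chain_nonneg)
    have "ennreal ((2 * y) ^ m * Q) * ennreal (y * A t * exp (- (y * A t)) / ((2 * y) ^ Suc m * Q / sech_chain m \<tau>))
        = ennreal ((2 * y) ^ m * Q * (y * A t * exp (- (y * A t)) / ((2 * y) ^ Suc m * Q / sech_chain m \<tau>)))"
      using y Q chain_pos A_pos[of t] by (intro ennreal_mult[symmetric]) auto
    also have "\<dots> = ennreal (A t * exp (- (A t * y)) * (sech_chain m \<tau> / 2))"
      using y Q by (intro arg_cong[where f = ennreal]) (simp add: field_simps)
    also have "\<dots> = ennreal (A t * exp (- (A t * y))) * ennreal (sech_chain m \<tau> / 2)"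
      using chain_pos A_pos[of t] by (intro ennreal_mult) auto
    finally show ?thesis
      unfolding E_eq P \<tau>_def[symmetric] Q_def .
  qed
  have "I_int (Suc m) = (\<integral>\<^sup>+u. (\<Prod>j<Suc m. indicator {0<..} (u j)) * E u \<partial>PiM {..<Suc m} (\<lambda>_. lborel))"
  proof -
    have "indicator {u. \<forall>j<k. 0 < u j} u = (\<Prod>j<k. indicator {0<..} (u j) :: ennreal)" for u :: "nat \<Rightarrow> real" and k
    proof (cases "\<forall>j<k. 0 < u j")
      case False
      then obtain j where "j \<in> {..<k}" "indicator {0<..} (u j) = (0 :: ennreal)" by auto
      then have "(\<Prod>j<k. indicator {0<..} (u j) :: ennreal) = 0"
        by (intro prod_zero) auto
      then show ?thesis
        using False by simp
    qed simp
    then show ?thesis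
      unfolding I_int_def E_def by (intro nn_integral_cong arg_cong2[where f = "(*)"] refl)
  qed
  also have "\<dots> = (\<integral>\<^sup>+y. \<integral>\<^sup>+x. (\<Prod>j<Suc m. indicator {0<..} ((x(m := y)) j)) * E (x(m := y)) \<partial>PiM {..<m} (\<lambda>_. lborel) \<partial>lborel)"
    unfolding lessThan_Suc
    by (rule product_nn_integral_insert_rev) (simp_all flip: lessThan_Suc)
  also have "\<dots> = (\<integral>\<^sup>+y. indicator {0<..} y * (\<integral>\<^sup>+x. (\<Prod>j<m. indicator {0<..} (x j)) * E (x(m := y)) \<partial>PiM {..<m} (\<lambda>_. lborel)) \<partial>lborel)"
  proof (rule nn_integral_cong)
    fix y :: real
    have "(\<Prod>j<Suc m. indicator {0<..} ((x(m := y)) j)) = (indicator {0<..} y * (\<Prod>j<m. indicator {0<..} (x j)) :: ennreal)" for x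
      by (simp add: mult.commute)
    then show "(\<integral>\<^sup>+x. (\<Prod>j<Suc m. indicator {0<..} ((x(m := y)) j)) * E (x(m := y)) \<partial>PiM {..<m} (\<lambda>_. lborel))
      = indicator {0<..} y * (\<integral>\<^sup>+x. (\<Prod>j<m. indicator {0<..} (x j)) * E (x(m := y)) \<partial>PiM {..<m} (\<lambda>_. lborel))"
      by (simp only: mult.assoc) (rule nn_integral_cmult, measurable)
  qed
  also have "\<dots> = (\<integral>\<^sup>+y. indicator {0<..} y * (\<integral>\<^sup>+t. (\<Prod>j<m. ennreal (2 * y * exp (2 * t j)))
      * E ((\<lambda>j\<in>{..<m}. y * exp (2 * t j))(m := y)) \<partial>PiM {..<m} (\<lambda>_. lborel)) \<partial>lborel)"
  proof (intro nn_integral_cong)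
    fix y :: real
    show "indicator {0<..} y * (\<integral>\<^sup>+x. (\<Prod>j<m. indicator {0<..} (x j)) * E (x(m := y)) \<partial>PiM {..<m} (\<lambda>_. lborel))
      = indicator {0<..} y * (\<integral>\<^sup>+t. (\<Prod>j<m. ennreal (2 * y * exp (2 * t j)))
         * E ((\<lambda>j\<in>{..<m}. y * exp (2 * t j))(m := y)) \<partial>PiM {..<m} (\<lambda>_. lborel))"
    proof (cases "y > 0")
      case True
      have "(\<integral>\<^sup>+x. (\<Prod>j<m. indicator {0<..} (x j)) * E (x(m := y)) \<partial>PiM {..<m} (\<lambda>_. lborel))
         = (\<integral>\<^sup>+t. (\<Prod>j<m. ennreal (2 * y * exp (2 * t j)))
         * E ((\<lambda>j\<in>{..<m}. y * exp (2 * t j))(m := y)) \<partial>PiM {..<m} (\<lambda>_. lborel))"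
        by (rule nn_integral_PiM_substitution[where F = "\<lambda>x. E (x(m := y))"])
           (use nn_integral_exp_substitution[OF _ True] in auto)
      then show ?thesis by simp
    qed simp
  qed
  also have "\<dots> = (\<integral>\<^sup>+y. \<integral>\<^sup>+t. indicator {0<..} y * ennreal (A t * exp (- (A t * y))) * ennreal (sech_chain m (t(m := 0)) / 2)
      \<partial>PiM {..<m} (\<lambda>_. lborel) \<partial>lborel)"
  proof (rule nn_integral_cong)
    fix y :: real
    show "indicator {0<..} y * (\<integral>\<^sup>+t. (\<Prod>j<m. ennreal (2 * y * exp (2 * t j)))
        * E ((\<lambda>j\<in>{..<m}. y * exp (2 * t j))(m := y)) \<partial>PiM {..<m} (\<lambda>_. lborel))
      = (\<integral>\<^sup>+t. indicator {0<..} y * ennreal (A t * exp (- (A t * y))) * ennreal (sech_chain m (t(m := 0)) / 2)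
        \<partial>PiM {..<m} (\<lambda>_. lborel))"
    proof (cases "y > 0")
      case True
      then have "indicator {0<..} y = (1 :: ennreal)" by simp
      then show ?thesis by (simp only: key[OF True] mult_1_left)
    qed simp
  qed
  \<comment> \<open>With \<open>y\<close> innermost, the exponential density integrates to 1
    whatever the rate, so \<open>A t\<close> disappears.\<close>
  also have "\<dots> = (\<integral>\<^sup>+t. \<integral>\<^sup>+y. indicator {0<..} y * ennreal (A t * exp (- (A t * y))) * ennreal (sech_chain m (t(m := 0)) / 2)
      \<partial>lborel \<partial>PiM {..<m} (\<lambda>_. lborel))"
    by (rule Fubini'[symmetric]) measurable
  also have "\<dots> = (\<integral>\<^sup>+t. ennreal (sech_chain m (t(m := 0)) / 2) \<partial>PiM {..<m} (\<lambda>_. lborel))"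
    by (simp add: nn_integral_multc nn_integral_exponential A_pos)
  finally have "2 * I_int (Suc m) = (\<integral>\<^sup>+t. 2 * ennreal (sech_chain m (t(m := 0)) / 2) \<partial>PiM {..<m} (\<lambda>_. lborel))"
    by (simp add: nn_integral_cmult)
  also have "\<dots> = (\<integral>\<^sup>+t. ennreal (sech_chain m (t(m := 0))) \<partial>PiM {..<m} (\<lambda>_. lborel))"
    by (intro nn_integral_cong) (simp add: sech_chain_nonneg flip: ennreal_numeral ennreal_mult)
  also have "\<dots> = sechc m 0"
    by (rule nn_integral_sech_chain)
  finally show ?thesis .
qed

section \<open>Evaluation at 0 and the Gamma quotient\<close>

lemma sechc_at_0:
  "sechc (Suc k) 0 = ennreal (2 * ((2 * pi) ^ k * (Gamma (real (k + 2) / 2))\<^sup>2 / Gamma (real (k + 2))))"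
proof (induction k rule: induct_nat_012)
  case 0
  show ?case
    unfolding sechc_1 by (simp add: csinh_def Gamma_numeral fact_numeral)
next
  case 1
  have "(1 / 2 :: real) \<notin> \<int>\<^sub>\<le>\<^sub>0"
    by (auto dest: nonpos_Ints_nonpos)
  then have "Gamma (3 / 2) = sqrt pi / 2"
    using Gamma_plus1[of "1 / 2 :: real"] by (simp add: Gamma_one_half_real)
  then have "(Gamma (3 / 2 :: real))\<^sup>2 = pi / 4"
    by (simp only: power_divide real_sqrt_pow2 pi_ge_zero) simp
  moreover have "Gamma (3 :: real) = 2"
    by (simp add: Gamma_numeral fact_numeral)
  ultimately show ?case
    unfolding sechc_2 by (simp add: power2_eq_square[of pi])
next
  case (ge2 k)
  define G where "G = Gamma (real (k + 2) / 2)"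
  define H where "H = Gamma (real (k + 2))"
  have "H > 0"
    unfolding H_def by (intro Gamma_real_pos) auto
  \<comment> \<open>Used with \<open>a = k + 2\<close> and \<open>b = k + 3\<close>: raising
    \<open>k\<close> by 2 multiplies the Gamma quotient by \<open>pi^2 a / b\<close>.\<close>
  have ratio: "(2 * pi) ^ Suc (Suc k) * (a / 2 * G)\<^sup>2 / (b * (a * H)) = pi\<^sup>2 * a / b * ((2 * pi) ^ k * G\<^sup>2 / H)"
    if "a > 0" "b > 0" for a b
    using that \<open>H > 0\<close> by (simp add: field_simps power2_eq_square)
  have cancel: "x = 2 * (pi\<^sup>2 * a / b * V)" if "a\<^sup>2 * pi\<^sup>2 * (2 * V) = a * b * x" "a > 0" "b > 0" for a b x V
    using that by (simp add: field_simps power2_eq_square)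
  have "1 + real k / 2 \<notin> \<int>\<^sub>\<le>\<^sub>0"
    using nonpos_Ints_nonpos[of "1 + real k / 2"] by auto
  then have "Gamma (real (Suc (Suc k) + 2) / 2) = real (k + 2) / 2 * G"
    using Gamma_plus1[of "real (k + 2) / 2"] unfolding G_def by (simp add: add_divide_distrib)
  moreover have "Gamma (real (Suc (Suc k) + 2)) = real (k + 3) * (real (k + 2) * H)"
    using Gamma_fact[of "k + 1", where 'a = real] Gamma_fact[of "k + 3", where 'a = real]
    unfolding H_def by (simp add: add_ac numeral_eq_Suc)
  ultimately have quotient: "(2 * pi) ^ Suc (Suc k) * (Gamma (real (Suc (Suc k) + 2) / 2))\<^sup>2 / Gamma (real (Suc (Suc k) + 2))
      = pi\<^sup>2 * real (k + 2) / real (k + 3) * ((2 * pi) ^ k * G\<^sup>2 / H)"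
    by (simp only: ratio of_nat_0_less_iff add_gr_0 zero_less_numeral simp_thms)
  obtain x where x: "sechc (Suc (Suc (Suc k))) 0 = ennreal x" "x \<ge> 0"
    using sechc_finite[of "Suc (Suc (Suc k))" 0] by (cases "sechc (Suc (Suc (Suc k))) 0") auto
  \<comment> \<open>The weighted term vanishes at \<open>s = 0\<close>, which leaves a two-step
    recurrence for the values with the same ratio.\<close>
  have "(real (Suc k) + 1)\<^sup>2 * pi\<^sup>2 * (2 * ((2 * pi) ^ k * G\<^sup>2 / H)) + 4 * 0 = (real (Suc k) + 1) * (real (Suc k) + 2) * x"
  proof (subst ennreal_linear_eq_iff[symmetric])
    show "ennreal ((real (Suc k) + 1)\<^sup>2 * pi\<^sup>2) * ennreal (2 * ((2 * pi) ^ k * G\<^sup>2 / H)) + 4 * ennreal 0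
      = ennreal ((real (Suc k) + 1) * (real (Suc k) + 2)) * ennreal x"
      using sechc_rec[of "Suc k"] ge2(1) x unfolding sechc_rec_def G_def[symmetric] H_def[symmetric]
      by (auto dest!: spec[of _ 0] simp: sqw_def simp del: sechc.simps)
  qed (use x \<open>H > 0\<close> in auto)
  then have "real (k + 2) ^ 2 * pi\<^sup>2 * (2 * ((2 * pi) ^ k * G\<^sup>2 / H)) = real (k + 2) * real (k + 3) * x"
    by (simp add: add_ac)
  then have "x = 2 * (pi\<^sup>2 * real (k + 2) / real (k + 3) * ((2 * pi) ^ k * G\<^sup>2 / H))"
    by (rule cancel) auto
  then show ?case
    by (simp only: x(1) quotient)
qed

lemma I_int_eq:
  assumes "n \<ge> 2"
  shows "I_int n = ennreal ((2 * pi) ^ (n - 2) * (Gamma (real n / 2))\<^sup>2 / Gamma (real n))" (is "_ = ennreal ?v")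
proof -
  obtain k where n: "n = Suc (Suc k)"
    using assms by (metis add_2_eq_Suc le_Suc_ex)
  have "2 * I_int n = ennreal (2 * ?v)"
    using I_int_Suc[of "Suc k"] sechc_at_0[of k] by (simp add: n)
  moreover have "?v \<ge> 0"
    using assms by (intro divide_nonneg_nonneg mult_nonneg_nonneg less_imp_le[OF Gamma_real_pos]) auto
  ultimately have "ennreal 2 * I_int n = ennreal (2 * ?v)" "2 * ?v \<ge> 0"
    by simp_all
  then have "I_int n = ennreal (2 * ?v / 2)"
    by (intro ennreal_mult_eq_imp_divide) auto
  then show ?thesis by simp
qed

theorem theorem4p26:
  shows "(\<forall>n::nat. n \<ge> 2 \<longrightarrow>
            I_int n = ennreal ((2 * pi) ^ (n - 2) * (Gamma (real n / 2))\<^sup>2 / Gamma (real n)))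
       \<and> (\<forall>n::nat. n \<ge> 1 \<longrightarrow>
            I_int (2 * n) = ennreal ((2 * pi) ^ (2 * n - 2) * (fact (n - 1))\<^sup>2 / fact (2 * n - 1))
          \<and> (2 * pi) ^ (2 * n - 2) * (fact (n - 1))\<^sup>2 / fact (2 * n - 1)
              = real n * (pi ^ (2 * (n - 1)) * 2 ^ (2 * n - 1) * (fact (n - 1))\<^sup>2 / fact (2 * n)))"
proof (intro conjI allI impI)
  fix n :: nat
  assume "n \<ge> 2"
  then show "I_int n = ennreal ((2 * pi) ^ (n - 2) * (Gamma (real n / 2))\<^sup>2 / Gamma (real n))"
    by (rule I_int_eq)
next
  fix n :: nat
  assume "n \<ge> 1"
  then obtain k where n: "n = Suc k"
    by (metis Suc_le_D One_nat_def)
  have "Gamma (real (Suc k)) = fact k" "Gamma (real (Suc (Suc (2 * k)))) = fact (Suc (2 * k))"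
    using Gamma_fact[of k, where 'a = real] Gamma_fact[of "Suc (2 * k)", where 'a = real] by (simp_all add: add_ac)
  moreover have "real (Suc (Suc (2 * k))) / 2 = real (Suc k)"
    by simp
  ultimately show "I_int (2 * n) = ennreal ((2 * pi) ^ (2 * n - 2) * (fact (n - 1))\<^sup>2 / fact (2 * n - 1))"
    using I_int_eq[of "2 * n"] by (simp add: n del: fact_Suc of_nat_Suc)
next
  fix n :: nat
  assume "n \<ge> 1"
  then obtain k where n: "n = Suc k"
    by (metis Suc_le_D One_nat_def)
  \<comment> \<open>The factor \<open>n\<close> cancels against \<open>(2 n)!\<close>, and the
    remaining 2 accounts for the exponent \<open>2 n - 1\<close> of 2 in place of
    \<open>2 n - 2\<close>.\<close>
  have "fact (2 * n) = real (2 * n) * fact (2 * n - 1)"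
    using fact_reduce[of "2 * n", where 'a = real] n by simp
  moreover have "(fact (2 * n - 1) :: real) \<noteq> 0"
    by simp
  moreover have "(2 * pi) ^ (2 * n - 2) * 2 = pi ^ (2 * (n - 1)) * 2 ^ (2 * n - 1)"
    by (simp add: n power_mult_distrib)
  ultimately show "(2 * pi) ^ (2 * n - 2) * (fact (n - 1))\<^sup>2 / fact (2 * n - 1)
              = real n * (pi ^ (2 * (n - 1)) * 2 ^ (2 * n - 1) * (fact (n - 1))\<^sup>2 / fact (2 * n))"
    using \<open>n \<ge> 1\<close> by (simp add: field_simps)
qed

end
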